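(* Let $\vartheta_{\mathbf P}=(\vartheta,\mathbf P)$ be a compatible, irreducible Pisot random substitution on $\mathcal A=\{1,\dots,d\}$ with Rauzy measures $(\overline\mu_a)_{a\in\mathcal A}$ and frequency measure $\varrho$. Let $w\in X_\vartheta^\infty\cap X_\vartheta'$ be a reference point such that $w$ is $\varrho$-generic and $\lim_{n\to\infty}\frac1n\mu_a(w_{[1,n]})=\overline\mu_a$ weakly for all $a\in\mathcal A$, and let $\phi\colon X_\vartheta'\to\mathcal R_\vartheta$ be the map determined by $\mathcal R(x)=\mathcal R(w)-\phi(x)$. Then the Rauzy measure $\mu=\sum_{a\in\mathcal A}\overline\mu_a$ coincides with $\varrho\circ\phi^{-1}$. Further, $\mu(x)\circ t_{\phi(x)}^{-1}=\mu$ holds for $\varrho$-almost every $x\in X_\vartheta$, where $t_{\phi(x)}(y)=y+\phi(x)$.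
   Context: Let $\mathcal A^+$ be the set of non-empty finite words over $\mathcal A$, $|u|$ the length of $u$, $|u|_i$ the number of occurrences of $i$ in $u$, $\psi(u)=(|u|_1,\dots,|u|_d)^T$, and $u_{[1,m]}=u_1\cdots u_m$ (empty if $m=0$; also for infinite sequences). $S$ is the left shift on $\mathcal A^{\mathbb N}$ (product topology); the shift-orbit of $x$ is $\{S^nx:n\ge0\}$. A random substitution $\vartheta_{\mathbf P}=(\vartheta,\mathbf P)$ is a map $\vartheta$ assigning to each letter $i$ a non-empty finite set $\vartheta(i)\subset\mathcal A^+$ together with probability vectors $p_i\colon\vartheta(i)\to(0,1]$, $\sum_{v\in\vartheta(i)}p_i(v)=1$. For a word $u=u_1\cdots u_n$, $\vartheta_{\mathbf P}(u)$ is the random word obtained by independently replacing each letter $u_k$ by $v\in\vartheta(u_k)$ with probability $p_{u_k}(v)$ and concatenating in order; $(\vartheta_{\mathbf P}^n(u))_{n\ge0}$ is the Markov chain on $\mathcal A^+$ started at $u$ with these transition probabilities, with expectation $\mathbb E$; $\vartheta^n(u)$ is the set of words attained by $\vartheta_{\mathbf P}^n(u)$ with positive probability. For a sequence $x$, $\vartheta(x)=\{v_1v_2\cdots:v_j\in\vartheta(x_j)\}$ and $\vartheta(X)=\bigcup_{x\in X}\vartheta(x)$. It is compatible if $\psi(u)=\psi(v)$ for all $a\in\mathcal A$, $u,v\in\vartheta(a)$; then all elements of $\vartheta^n(v)$ have a common length $|\vartheta^n(v)|$, and the substitution matrix is $M_{i,j}=|v|_i$ for any $v\in\vartheta(j)$.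 It is primitive if $M$ is primitive with Perron–Frobenius eigenvalue $\lambda>1$. A compatible primitive random substitution is irreducible Pisot if $\lambda$ is a Pisot number and the characteristic polynomial of $M$ is irreducible over $\mathbb Z$. $X_\vartheta$ is the set of $x\in\mathcal A^{\mathbb N}$ all of whose finite subwords are subwords of some element of $\vartheta^k(a)$, $a\in\mathcal A$, $k\in\mathbb N$. $X_\vartheta^\infty=\bigcap_{n\ge0}\vartheta^n(X_\vartheta)$, and $X_\vartheta'$ is the set of points of $X_\vartheta$ with dense shift-orbit in $X_\vartheta$. The frequency measure $\varrho$ is the $S$-invariant ergodic probability measure on $X_\vartheta$ such that $\varrho([u])$ is the almost sure limit, as $n\to\infty$, of the relative frequency of the word $u$ in $\vartheta_{\mathbf P}^n(a)$ (for any $a\in\mathcal A$), where $[u]$ is the cylinder of sequences with prefix $u$; moreover, for each $\vartheta_{\mathbf P}$-invariant probability measure $\nu$ on $X_\vartheta$ (i.e. $\nu([u])=\sum_{|v|=|u|}\nu([v])\,\mathbb P[\vartheta_{\mathbf P}(v)_{[1,|u|]}=u]$ for all legal $u$, the sum being over legal words), $\nu$-almost every point is $\varrho$-generic. A point $x$ is $\varrho$-generic if $\frac1n\sum_{k=0}^{n-1}\delta_{S^kx}\to\varrho$ weakly. $\mathbf L,\mathbf R$ are left and right Perron–Frobenius eigenvectors of $M$ with $\|\mathbf R\|_1=1=\mathbf L^T\mathbf R$; $\mathbb H\subset\mathbb R^d$ is the hyperplane orthogonal to $\mathbf L$; $\pi$ is the linear projection along $\mathbf R$ onto $\mathbb H$.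 For $x\in X_\vartheta$, $\mathcal R(x)=\overline{\{\pi(\psi(x_{[1,n]})):n\ge0\}}$ (a compact set). $\mathcal R_\vartheta=\mathcal R(w)$ for any $w\in X_\vartheta^\infty\cap X_\vartheta'$ (independent of $w$). For $x\in X_\vartheta'$ there is a unique vector $\phi(x)\in\mathcal R(w)$ with $\mathcal R(x)=\mathcal R(w)-\phi(x)$; in particular $\phi(w)=0$. For a finite word $u$, $\mu_a(u)=\sum_{0\le m\le|u|-1,\ u_{m+1}=a}\delta_{\pi(\psi(u_{[1,m]}))}$. The Rauzy measure $\overline\mu_a$ is the weak limit $\lim_{n\to\infty}|\vartheta^n(v)|^{-1}\,\mathbb E[\mu_a(\vartheta_{\mathbf P}^n(v))]$, which exists and is the same for every $v\in\mathcal A^+$. For an infinite sequence $x$, $\mu(x)=\lim_{n\to\infty}\frac1n\sum_{i=1}^n\delta_{\pi(\psi(x_{[1,i]}))}$ whenever this weak limit exists. *)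

theory Defs
  imports "HOL-Probability.Probability" "HOL-Library.Sublist"
begin

section \<open>Words and sequences\<close>

text \<open>
  The alphabet is the universe of a finite type \<open>'a\<close>, so \<open>d = CARD('a)\<close>. A sequence
  \<open>x\<^sub>1 x\<^sub>2 \<dots>\<close> is a function \<open>x :: nat \<Rightarrow> 'a\<close> with \<open>x\<^sub>j = x (j - 1)\<close>.
\<close>

definition parikh :: "'a::finite list \<Rightarrow> real ^ 'a" where
  "parikh u = (\<chi> i. real (count_list u i))"

definition seq_take :: "nat \<Rightarrow> (nat \<Rightarrow> 'a) \<Rightarrow> 'a list" where
  "seq_take n x = map x [0..<n]"

definition lshift :: "(nat \<Rightarrow> 'a) \<Rightarrow> (nat \<Rightarrow> 'a)" where
  "lshift x = (\<lambda>n. x (Suc n))"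

definition cylinder :: "'a list \<Rightarrow> (nat \<Rightarrow> 'a) set" where
  "cylinder u = {x. seq_take (length u) x = u}"

definition seq_top :: "(nat \<Rightarrow> 'a) topology" where
  "seq_top = product_topology (\<lambda>_. discrete_topology UNIV) UNIV"

text \<open>For finite \<open>'a\<close> this product \<open>\<sigma>\<close>-algebra is the Borel \<open>\<sigma>\<close>-algebra of \<^const>\<open>seq_top\<close>.\<close>

definition seq_space :: "(nat \<Rightarrow> 'a) measure" where
  "seq_space = PiM UNIV (\<lambda>_. count_space UNIV)"

definition occurrences :: "'a list \<Rightarrow> 'a list \<Rightarrow> nat" where
  "occurrences u v = card {k. k + length u \<le> length v \<and> take (length u) (drop k v) = u}"


section \<open>Measures\<close>

definition sum_measure :: "'b measure \<Rightarrow> 'i set \<Rightarrow> ('i \<Rightarrow> 'b measure) \<Rightarrow> 'b measure" where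
  "sum_measure N I M = measure_of (space N) (sets N) (\<lambda>B. \<Sum>i\<in>I. emeasure (M i) B)"

text \<open>The expectation of a random measure, taken setwise.\<close>

definition expected_measure :: "'b measure \<Rightarrow> 'c pmf \<Rightarrow> ('c \<Rightarrow> 'b measure) \<Rightarrow> 'b measure" where
  "expected_measure N p M =
     measure_of (space N) (sets N) (\<lambda>B. \<integral>\<^sup>+ c. emeasure (M c) B \<partial>measure_pmf p)"

definition weak_limit :: "'b topology \<Rightarrow> (nat \<Rightarrow> 'b measure) \<Rightarrow> 'b measure \<Rightarrow> bool" where
  "weak_limit T M N \<longleftrightarrow>
     finite_measure N \<and> (\<forall>n. sets (M n) = sets N) \<and>
     (\<forall>f. continuous_map T euclideanreal f \<and> bounded (f ` topspace T) \<longrightarrow>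
        (\<lambda>n. \<integral>x. f x \<partial>M n) \<longlonglongrightarrow> (\<integral>x. f x \<partial>N))"

definition generic_point :: "(nat \<Rightarrow> 'a) measure \<Rightarrow> (nat \<Rightarrow> 'a) \<Rightarrow> bool" where
  "generic_point \<rho> x \<longleftrightarrow>
     weak_limit seq_top
       (\<lambda>n. scale_measure (ennreal (1 / real n))
              (sum_measure seq_space {..<n} (\<lambda>k. return seq_space ((lshift ^^ k) x)))) \<rho>"


section \<open>Random substitutions\<close>

text \<open>
  A random substitution is encoded as \<open>\<theta> :: 'a \<Rightarrow> 'a list pmf\<close>: the set of images of a letter \<open>a\<close>
  is \<open>set_pmf (\<theta> a)\<close>, and the probability vector on it is \<open>pmf (\<theta> a)\<close>.
\<close>

definition random_substitution :: "('a::finite \<Rightarrow> 'a list pmf) \<Rightarrow> bool" where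
  "random_substitution \<theta> \<longleftrightarrow> (\<forall>a. finite (set_pmf (\<theta> a)) \<and> [] \<notin> set_pmf (\<theta> a))"

primrec subst_word :: "('a \<Rightarrow> 'a list pmf) \<Rightarrow> 'a list \<Rightarrow> 'a list pmf" where
  "subst_word \<theta> [] = return_pmf []"
| "subst_word \<theta> (a # u) = bind_pmf (\<theta> a) (\<lambda>v. map_pmf (\<lambda>w. v @ w) (subst_word \<theta> u))"

primrec subst_pow :: "('a \<Rightarrow> 'a list pmf) \<Rightarrow> nat \<Rightarrow> 'a list \<Rightarrow> 'a list pmf" where
  "subst_pow \<theta> 0 u = return_pmf u"
| "subst_pow \<theta> (Suc n) u = bind_pmf (subst_pow \<theta> n u) (subst_word \<theta>)"

text \<open>
  \<open>Q\<close> is the law, on the path space, of the Markov chain started at \<open>u\<close>; it is determined by its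
  finite-dimensional distributions.
\<close>

definition subst_chain_law ::
    "('a \<Rightarrow> 'a list pmf) \<Rightarrow> 'a list \<Rightarrow> (nat \<Rightarrow> 'a list) measure \<Rightarrow> bool" where
  "subst_chain_law \<theta> u Q \<longleftrightarrow>
     prob_space Q \<and> sets Q = sets (PiM UNIV (\<lambda>_. count_space UNIV)) \<and>
     (\<forall>n v. measure Q {\<omega>. \<forall>k\<le>n. \<omega> k = v k} =
        (if v 0 = u then \<Prod>k<n. pmf (subst_word \<theta> (v k)) (v (Suc k)) else 0))"

definition compatible :: "('a::finite \<Rightarrow> 'a list pmf) \<Rightarrow> bool" where
  "compatible \<theta> \<longleftrightarrow> (\<forall>a. \<forall>u\<in>set_pmf (\<theta> a). \<forall>v\<in>set_pmf (\<theta> a). parikh u = parikh v)"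

text \<open>The two definite descriptions below are meaningful for compatible \<open>\<theta>\<close>.\<close>

definition common_length :: "('a \<Rightarrow> 'a list pmf) \<Rightarrow> nat \<Rightarrow> 'a list \<Rightarrow> nat" where
  "common_length \<theta> n v = (THE m. \<forall>u\<in>set_pmf (subst_pow \<theta> n v). length u = m)"

definition subst_matrix :: "('a::finite \<Rightarrow> 'a list pmf) \<Rightarrow> 'b::semiring_1 ^ 'a ^ 'a" where
  "subst_matrix \<theta> = (\<chi> i j. of_nat (THE m. \<forall>v\<in>set_pmf (\<theta> j). count_list v i = m))"

definition primitive_matrix :: "int ^ 'n ^ 'n \<Rightarrow> bool" where
  "primitive_matrix M \<longleftrightarrow> (\<exists>n>0. \<forall>i j. 0 < (((**) M ^^ n) (mat 1)) $ i $ j)"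

definition charpoly :: "int ^ 'n ^ 'n \<Rightarrow> int poly" where
  "charpoly M = det (\<chi> i j. (if i = j then [:0, 1:] else 0) - [:M $ i $ j:])"

definition pf_eigenvalue :: "real ^ 'n ^ 'n \<Rightarrow> real \<Rightarrow> bool" where
  "pf_eigenvalue M lam \<longleftrightarrow>
     (\<exists>v. v \<noteq> 0 \<and> M *v v = lam *\<^sub>R v) \<and>
     (\<forall>z v. v \<noteq> 0 \<and> map_matrix complex_of_real M *v v = z *s v \<longrightarrow> cmod z \<le> lam)"

definition pisot_number :: "real \<Rightarrow> bool" where
  "pisot_number x \<longleftrightarrow> x > 1 \<and>
     (\<exists>p :: int poly. lead_coeff p = 1 \<and> irreducible p \<and> poly (map_poly of_int p) x = 0 \<and>
        (\<forall>z :: complex. poly (map_poly of_int p) z = 0 \<and> z \<noteq> complex_of_real x \<longrightarrow> cmod z < 1))"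

definition primitive_substitution :: "('a::finite \<Rightarrow> 'a list pmf) \<Rightarrow> bool" where
  "primitive_substitution \<theta> \<longleftrightarrow>
     primitive_matrix (subst_matrix \<theta>) \<and> (\<exists>lam. pf_eigenvalue (subst_matrix \<theta>) lam \<and> lam > 1)"

definition irreducible_pisot :: "('a::finite \<Rightarrow> 'a list pmf) \<Rightarrow> bool" where
  "irreducible_pisot \<theta> \<longleftrightarrow>
     compatible \<theta> \<and> primitive_substitution \<theta> \<and>
     (\<exists>lam. pf_eigenvalue (subst_matrix \<theta>) lam \<and> pisot_number lam) \<and>
     irreducible (charpoly (subst_matrix \<theta>))"


section \<open>The random substitution subshift\<close>

definition subshift :: "('a::finite \<Rightarrow> 'a list pmf) \<Rightarrow> (nat \<Rightarrow> 'a) set" where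
  "subshift \<theta> =
     {x. \<forall>i j. \<exists>a k. \<exists>v\<in>set_pmf (subst_pow \<theta> k [a]). sublist (map x [i..<j]) v}"

text \<open>\<open>y = v\<^sub>1 v\<^sub>2 \<dots>\<close> is expressed through the prefixes \<open>v\<^sub>1 \<dots> v\<^sub>n\<close> of \<open>y\<close>.\<close>

definition subst_seq :: "('a \<Rightarrow> 'a list pmf) \<Rightarrow> (nat \<Rightarrow> 'a) \<Rightarrow> (nat \<Rightarrow> 'a) set" where
  "subst_seq \<theta> x =
     {y. \<exists>v. (\<forall>j. v j \<in> set_pmf (\<theta> (x j))) \<and>
             (\<forall>n. y \<in> cylinder (concat (map v [0..<n])))}"

definition subst_set :: "('a \<Rightarrow> 'a list pmf) \<Rightarrow> (nat \<Rightarrow> 'a) set \<Rightarrow> (nat \<Rightarrow> 'a) set" where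
  "subst_set \<theta> X = (\<Union>x\<in>X. subst_seq \<theta> x)"

definition subshift_inf :: "('a::finite \<Rightarrow> 'a list pmf) \<Rightarrow> (nat \<Rightarrow> 'a) set" where
  "subshift_inf \<theta> = (\<Inter>n. (subst_set \<theta> ^^ n) (subshift \<theta>))"

definition subshift_dense :: "('a::finite \<Rightarrow> 'a list pmf) \<Rightarrow> (nat \<Rightarrow> 'a) set" where
  "subshift_dense \<theta> =
     {x \<in> subshift \<theta>. subshift \<theta> \<subseteq> seq_top closure_of (range (\<lambda>n. (lshift ^^ n) x))}"

definition frequency_measure :: "('a::finite \<Rightarrow> 'a list pmf) \<Rightarrow> (nat \<Rightarrow> 'a) measure \<Rightarrow> bool" where
  "frequency_measure \<theta> \<rho> \<longleftrightarrow>
     prob_space \<rho> \<and> sets \<rho> = sets seq_space \<and> (AE x in \<rho>. x \<in> subshift \<theta>) \<and>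
     distr \<rho> seq_space lshift = \<rho> \<and>
     (\<forall>A\<in>sets \<rho>. lshift -` A = A \<longrightarrow> measure \<rho> A = 0 \<or> measure \<rho> A = 1) \<and>
     (\<forall>a. \<exists>Q. subst_chain_law \<theta> [a] Q \<and>
        (AE \<omega> in Q. \<forall>u. (\<lambda>n. real (occurrences u (\<omega> n)) / real (length (\<omega> n)))
                          \<longlonglongrightarrow> measure \<rho> (cylinder u)))"


section \<open>Rauzy fractals and Rauzy measures\<close>

definition pf_eigenvectors :: "real ^ 'n ^ 'n \<Rightarrow> real ^ 'n \<Rightarrow> real ^ 'n \<Rightarrow> bool" where
  "pf_eigenvectors M L R \<longleftrightarrow>
     (\<exists>lam. pf_eigenvalue M lam \<and> L v* M = lam *\<^sub>R L \<and> M *v R = lam *\<^sub>R R) \<and>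
     (\<forall>i. 0 < L $ i) \<and> (\<forall>i. 0 < R $ i) \<and>
     (\<Sum>i\<in>UNIV. \<bar>R $ i\<bar>) = 1 \<and> L \<bullet> R = 1"

text \<open>The projection along \<open>R\<close> onto the hyperplane orthogonal to \<open>L\<close>, given \<open>L \<bullet> R = 1\<close>.\<close>

definition hyp_proj :: "real ^ 'n \<Rightarrow> real ^ 'n \<Rightarrow> real ^ 'n \<Rightarrow> real ^ 'n" where
  "hyp_proj L R v = v - (L \<bullet> v) *\<^sub>R R"

lemma hyp_proj_unique:
  assumes "L \<bullet> R = 1"
  shows "L \<bullet> h = 0 \<and> (\<exists>c. v - h = c *\<^sub>R R) \<longleftrightarrow> h = hyp_proj L R v"
proof
  assume "L \<bullet> h = 0 \<and> (\<exists>c. v - h = c *\<^sub>R R)"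
  then obtain c where h: "L \<bullet> h = 0" and c: "v = h + c *\<^sub>R R"
    by (metis add.commute diff_add_cancel)
  then show "h = hyp_proj L R v"
    using assms by (simp add: hyp_proj_def inner_add_right)
qed (use assms in \<open>auto simp: hyp_proj_def inner_diff_right\<close>)

definition rauzy_point :: "real ^ 'a \<Rightarrow> real ^ 'a \<Rightarrow> 'a::finite list \<Rightarrow> real ^ 'a" where
  "rauzy_point L R u = hyp_proj L R (parikh u)"

definition rauzy_set :: "real ^ 'a \<Rightarrow> real ^ 'a \<Rightarrow> (nat \<Rightarrow> 'a::finite) \<Rightarrow> (real ^ 'a) set" where
  "rauzy_set L R x = closure {rauzy_point L R (seq_take n x) | n. True}"

text \<open>\<open>rauzy_shift L R w\<close> is the map \<open>\<phi>\<close>; it is only meaningful on \<open>subshift_dense \<theta>\<close>.\<close>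

definition rauzy_shift ::
    "real ^ 'a \<Rightarrow> real ^ 'a \<Rightarrow> (nat \<Rightarrow> 'a::finite) \<Rightarrow> (nat \<Rightarrow> 'a) \<Rightarrow> real ^ 'a" where
  "rauzy_shift L R w x =
     (THE v. v \<in> rauzy_set L R w \<and> rauzy_set L R x = (\<lambda>y. y - v) ` rauzy_set L R w)"

text \<open>Measures on the hyperplane are regarded as Borel measures on the ambient space.\<close>

definition word_measure ::
    "real ^ 'a \<Rightarrow> real ^ 'a \<Rightarrow> 'a \<Rightarrow> 'a::finite list \<Rightarrow> (real ^ 'a) measure" where
  "word_measure L R a u =
     sum_measure borel {m. m < length u \<and> u ! m = a}
       (\<lambda>m. return borel (rauzy_point L R (take m u)))"

definition rauzy_measure ::
    "('a::finite \<Rightarrow> 'a list pmf) \<Rightarrow> real ^ 'a \<Rightarrow> real ^ 'a \<Rightarrow> 'a \<Rightarrow> (real ^ 'a) measure \<Rightarrow> bool" where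
  "rauzy_measure \<theta> L R a N \<longleftrightarrow>
     (\<forall>v. v \<noteq> [] \<longrightarrow>
        weak_limit euclidean
          (\<lambda>n. scale_measure (ennreal (1 / real (common_length \<theta> n v)))
                 (expected_measure borel (subst_pow \<theta> n v) (word_measure L R a))) N)"

definition sequence_measure ::
    "real ^ 'a \<Rightarrow> real ^ 'a \<Rightarrow> (nat \<Rightarrow> 'a::finite) \<Rightarrow> (real ^ 'a) measure \<Rightarrow> bool" where
  "sequence_measure L R x N \<longleftrightarrow>
     weak_limit euclidean
       (\<lambda>n. scale_measure (ennreal (1 / real n))
              (sum_measure borel {1..n} (\<lambda>i. return borel (rauzy_point L R (seq_take i x))))) N"

end

theory Submission
  imports Defs
    "HOL-Computational_Algebra.Polynomial_Factorial"
    "HOL-Computational_Algebra.Fundamental_Theorem_Algebra"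
begin

text \<open>
  Let \<open>p\<^sub>n(x)\<close> denote the projection to the hyperplane of the abelianisation of the first \<open>n\<close> letters
  of \<open>x\<close>, and let \<open>S\<close> be the shift. The proof rests on two properties of the map \<open>\<phi>\<close>: the walk \<open>p\<close> is
  its coboundary, that is, \<open>p\<^sub>n(x) = \<phi>(S\<^sup>n x) - \<phi>(x)\<close>, and \<open>\<phi>\<close> is continuous on the set of points with
  dense orbit. The first property turns the empirical measure of the walk of \<open>x\<close> into the image under
  \<open>\<phi>\<close> of the empirical measure of the orbit of \<open>x\<close>, translated by \<open>- \<phi>(x)\<close>. The second property allows
  the passage to the limit for every \<open>x\<close> in which cylinders have the frequencies prescribed by \<open>\<rho>\<close>.
  The reference point \<open>w\<close> is such a point with \<open>\<phi>(w) = 0\<close>, and comparing with the assumed limits for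
  \<open>w\<close> gives \<open>\<mu> = \<rho> \<circ> \<phi>\<^sup>-\<^sup>1\<close>; the ergodic theorem shows that \<open>\<rho>\<close>-almost every point is of this
  kind, which gives the second claim.

  Both properties of \<open>\<phi>\<close> follow from one compactness argument. Suppose that, along some sequence of
  indices \<open>n\<close>, the shifts \<open>S\<^sup>n w\<close> converge to a point \<open>x\<close> with dense orbit and \<open>p\<^sub>n(w)\<close> converges to \<open>v\<close>.
  Then \<open>\<R>(x) + v \<subseteq> \<R>(w)\<close>. Exchanging the roles of \<open>w\<close> and \<open>x\<close> gives an inclusion in the other
  direction, and as a bounded set cannot contain a non-trivial translate of itself,
  \<open>\<R>(x) = \<R>(w) - v\<close> (\<open>rauzy_shift_eq_limit\<close>). So \<open>p\<^sub>n(w)\<close> tends to \<open>\<phi>(x)\<close> whenever \<open>S\<^sup>n w\<close> tends to \<open>x\<close>.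

  Three ingredients remain. The set \<open>\<R>(w)\<close> is bounded because the substitution matrix contracts the
  hyperplane (\<open>summable_orbit_in_hyperplane\<close>, \<open>rauzy_points_of_subshift_bounded\<close>): irreducibility and
  the Pisot property force all its eigenvalues there to lie inside the unit disc. Points with the
  right cylinder frequencies have dense orbits because every legal word has positive frequency
  (\<open>frequency_pos\<close>), which is obtained by bounding the expected frequency from below. Finally,
  almost every point has the right frequencies by Birkhoff's theorem, proved here for bounded
  functions (\<open>birkhoff_ergodic_theorem\<close>).
\<close>

section \<open>Contraction of a matrix on an invariant hyperplane\<close>

text \<open>Summing the recurrence over \<open>n\<close> bounds every partial sum of \<open>a\<close> by \<open>(a\<^sub>0 + \<Sum>b) / (1 - r)\<close>.\<close>

lemma summable_if_contracting_recurrence: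
  fixes a b :: "nat \<Rightarrow> real"
  assumes a: "\<And>n. 0 \<le> a n" and b: "\<And>n. 0 \<le> b n" "summable b"
    and r: "0 \<le> r" "r < 1" and rec: "\<And>n. a (Suc n) \<le> r * a n + b n"
  shows "summable a"
proof (rule summableI_nonneg_bounded)
  fix n
  let ?C = "(a 0 + suminf b) / (1 - r)"
  have C: "a 0 + r * ?C + suminf b = ?C"
    using r by (simp add: field_simps)
  have "0 \<le> ?C"
    using a b r by (simp add: suminf_nonneg)
  show "(\<Sum>i<n. a i) \<le> ?C"
  proof (induction n)
    case 0
    show ?case using \<open>0 \<le> ?C\<close> by simp
  next
    case (Suc n)
    have "(\<Sum>i<Suc n. a i) = a 0 + (\<Sum>i<n. a (Suc i))"
      by (rule sum.lessThan_Suc_shift)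
    also have "\<dots> \<le> a 0 + (\<Sum>i<n. r * a i + b i)"
      using rec by (intro add_left_mono sum_mono) auto
    also have "\<dots> = a 0 + r * (\<Sum>i<n. a i) + (\<Sum>i<n. b i)"
      by (simp add: sum.distrib sum_distrib_left)
    also have "\<dots> \<le> a 0 + r * ?C + suminf b"
      using Suc b r by (intro add_mono mult_left_mono sum_le_suminf) auto
    finally show ?case using C by simp
  qed
qed (use a in auto)

lemma norm_smult_vec: "norm (c *s v) = cmod c * norm (v :: complex ^ 'n)"
  by (simp add: norm_vec_def norm_mult L2_set_right_distrib)

text \<open>This is the vector \<open>p(A) h\<close>, evaluated by Horner's scheme.\<close>

definition matrix_poly :: "complex ^ 'n ^ 'n \<Rightarrow> complex ^ 'n \<Rightarrow> complex poly \<Rightarrow> complex ^ 'n" where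
  "matrix_poly A h p = fold_coeffs (\<lambda>a v. a *s h + A *v v) p 0"

lemma matrix_poly_0 [simp]: "matrix_poly A h 0 = 0"
  by (simp add: matrix_poly_def)

lemma matrix_poly_pCons [simp]: "matrix_poly A h (pCons a p) = a *s h + A *v matrix_poly A h p"
  by (cases "p = 0 \<and> a = 0") (auto simp: matrix_poly_def)

lemma matrix_poly_add: "matrix_poly A h (p + q) = matrix_poly A h p + matrix_poly A h q"
  by (induction p q rule: poly_induct2)
     (simp_all add: matrix_vector_right_distrib algebra_simps)

lemma matrix_vector_mult_smult: "A *v (c *s x) = (c :: 'b :: comm_semiring_1) *s (A *v x)"
  by (simp add: vec_eq_iff matrix_vector_mult_def sum_distrib_left mult_ac)

lemma matrix_poly_smult: "matrix_poly A h (smult c p) = c *s matrix_poly A h p"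
  by (induction p) (simp_all add: vector_add_ldistrib vector_smult_assoc matrix_vector_mult_smult)

lemma matrix_poly_linear_factor:
  "matrix_poly A h ([:- z, 1:] * p) = A *v matrix_poly A h p - z *s matrix_poly A h p"
proof -
  have "[:- z, 1:] * p = pCons 0 p + smult (- z) p"
    by simp
  then show ?thesis
    by (simp only: matrix_poly_add matrix_poly_smult matrix_poly_pCons) (simp add: vec_eq_iff)
qed

lemma matrix_poly_monom:
  fixes A :: "complex ^ 'n ^ 'n"
  shows "matrix_poly A h (monom c n) = c *s (((*v) A ^^ n) h)"
  by (induction n) (simp_all add: monom_0 monom_Suc matrix_vector_mult_smult)

lemma matrix_poly_sum: "matrix_poly A h (\<Sum>i\<in>I. f i) = (\<Sum>i\<in>I. matrix_poly A h (f i))"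
  by (induction I rule: infinite_finite_induct) (simp_all add: matrix_poly_add)

text \<open>
  The vectors \<open>h, A h, A\<^sup>2 h, \<dots>\<close> up to the exponent given by the real dimension are linearly dependent
  or not distinct.
\<close>

lemma ex_annihilating_poly:
  fixes A :: "complex ^ 'n ^ 'n"
  shows "\<exists>p. p \<noteq> 0 \<and> matrix_poly A h p = 0"
proof -
  let ?N = "DIM(complex ^ 'n)"
  define f where "f i = ((*v) A ^^ i) h" for i
  have *: "\<exists>p. p \<noteq> 0 \<and> matrix_poly A h p = 0"
    if "(\<Sum>i\<le>?N. c i *s f i) = 0" "c j \<noteq> 0" "j \<le> ?N" for c :: "nat \<Rightarrow> complex" and j
  proof -
    define p where "p = (\<Sum>i\<le>?N. monom (c i) i)"
    have "coeff p j = c j"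
      using that(3) by (simp add: p_def coeff_sum)
    then have "p \<noteq> 0" using that(2) by auto
    moreover have "matrix_poly A h p = 0"
      using that(1) by (simp add: p_def matrix_poly_sum matrix_poly_monom f_def)
    ultimately show ?thesis by blast
  qed
  show ?thesis
  proof (cases "inj_on f {..?N}")
    case True
    then have "card (f ` {..?N}) > DIM(complex ^ 'n)"
      by (simp add: card_image)
    then have "dependent (f ` {..?N})"
      by (intro dependent_biggerset) auto
    then obtain u j where u: "(\<Sum>v\<in>f ` {..?N}. u v *\<^sub>R v) = 0" and j: "j \<le> ?N" "u (f j) \<noteq> 0"
      by (subst (asm) dependent_finite) auto
    have "(\<Sum>i\<le>?N. complex_of_real (u (f i)) *s f i) = (\<Sum>i\<le>?N. u (f i) *\<^sub>R f i)"
      by (intro sum.cong) (auto simp: vec_eq_iff scaleR_conv_of_real[where 'a = complex])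
    also have "\<dots> = 0"
      using u True by (simp add: sum.reindex)
    finally show ?thesis using j by (intro *[of "\<lambda>i. of_real (u (f i))" j]) auto
  next
    case False
    then obtain i j where ij: "i \<le> ?N" "j \<le> ?N" "i \<noteq> j" "f i = f j"
      by (auto simp: inj_on_def)
    define c :: "nat \<Rightarrow> complex" where "c k = (if k = i then 1 else if k = j then - 1 else 0)" for k
    have "(\<Sum>k\<le>?N. c k *s f k) = (\<Sum>k\<in>{i, j}. c k *s f k)"
      by (rule sum.mono_neutral_right) (use ij in \<open>auto simp: c_def\<close>)
    also have "\<dots> = 0"
      using ij by (simp add: c_def)
    finally show ?thesis using ij by (intro *[of c i]) (auto simp: c_def)
  qed
qed

lemma funpow_matrix_diff_smult:
  fixes A :: "complex ^ 'n ^ 'n"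
  shows "((*v) A ^^ n) (A *v y - z *s y) = ((*v) A ^^ Suc n) y - (z :: complex) *s (((*v) A ^^ n) y)"
  by (induction n) (simp_all add: matrix_vector_mult_diff_distrib matrix_vector_mult_smult)

lemma funpow_matrix_smult:
  fixes A :: "complex ^ 'n ^ 'n"
  shows "((*v) A ^^ n) (c *s y) = (c :: complex) *s (((*v) A ^^ n) y)"
  by (induction n) (simp_all add: matrix_vector_mult_smult)

lemma degree_linear_factor: "q \<noteq> 0 \<Longrightarrow> degree ([:- z, 1:] * q) = Suc (degree (q :: complex poly))"
  by (subst degree_mult_eq) auto

text \<open>
  A linear factor \<open>X - z\<close> of \<open>p\<close> can be split off: the norms of \<open>A\<^sup>n y\<close> satisfy a recurrence with the
  ratio \<open>|z| < 1\<close> and the norms of \<open>A\<^sup>n (A - z) y\<close> as perturbation.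
\<close>

lemma summable_orbit_matrix_poly:
  fixes A :: "complex ^ 'n ^ 'n"
  assumes "p \<noteq> 0" "\<And>z. poly p z = 0 \<Longrightarrow> cmod z < 1"
    and "summable (\<lambda>n. norm (((*v) A ^^ n) (matrix_poly A h p)))"
  shows "summable (\<lambda>n. norm (((*v) A ^^ n) h))"
  using assms
proof (induction "degree p" arbitrary: p)
  case 0
  then obtain c where p: "p = [:c:]" "c \<noteq> 0"
    by (metis degree_eq_zeroE pCons_eq_0_iff)
  have "summable (\<lambda>n. cmod c * norm (((*v) A ^^ n) h))"
    using "0.prems"(3) by (simp add: p funpow_matrix_smult norm_smult_vec)
  then show ?case using p by simp
next
  case (Suc d)
  then have "\<not> constant (poly p)"
    by (metis constant_degree nat.distinct(1))
  then obtain z where z: "poly p z = 0"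
    using fundamental_theorem_of_algebra by blast
  then obtain q where q: "p = [:- z, 1:] * q"
    by (auto simp: poly_eq_0_iff_dvd)
  then have "q \<noteq> 0" using Suc.prems by auto
  then have deg: "d = degree q"
    using Suc.hyps(2) degree_linear_factor unfolding q by simp
  define y where "y = matrix_poly A h q"
  have eq: "((*v) A ^^ Suc n) y = z *s (((*v) A ^^ n) y) + ((*v) A ^^ n) (matrix_poly A h p)" for n
    unfolding q matrix_poly_linear_factor y_def funpow_matrix_diff_smult by simp
  have "summable (\<lambda>n. norm (((*v) A ^^ n) y))"
  proof (rule summable_if_contracting_recurrence[OF _ _ Suc.prems(3)])
    show "0 \<le> cmod z" "cmod z < 1" using Suc.prems(2) z by auto
    show "norm (((*v) A ^^ Suc n) y) \<le>
      cmod z * norm (((*v) A ^^ n) y) + norm (((*v) A ^^ n) (matrix_poly A h p))" for n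
      unfolding eq by (metis norm_triangle_ineq norm_smult_vec)
  qed auto
  then show ?case
    using Suc.hyps(1)[OF deg \<open>q \<noteq> 0\<close>] Suc.prems(2) by (simp add: y_def q)
qed

text \<open>
  Choose a polynomial \<open>p\<close> of least degree with \<open>p(A) h = 0\<close>. For each zero \<open>z\<close> of \<open>p\<close>, the vector
  \<open>q(A) h\<close> with \<open>p = (X - z) q\<close> is nonzero by minimality, and therefore an eigenvector for \<open>z\<close> in the
  kernel of the functional \<open>l\<close>.
\<close>

lemma summable_orbit_if_small_eigenvalues:
  fixes A :: "complex ^ 'n ^ 'n" and l :: "complex ^ 'n"
  assumes left: "\<And>v. (\<Sum>i\<in>UNIV. l $ i * (A *v v) $ i) = lam * (\<Sum>i\<in>UNIV. l $ i * v $ i)"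
    and small: "\<And>y z. y \<noteq> 0 \<Longrightarrow> (\<Sum>i\<in>UNIV. l $ i * y $ i) = 0 \<Longrightarrow> A *v y = z *s y \<Longrightarrow> cmod z < 1"
    and h: "(\<Sum>i\<in>UNIV. l $ i * h $ i) = 0"
  shows "summable (\<lambda>n. norm (((*v) A ^^ n) h))"
proof -
  have inv: "(\<Sum>i\<in>UNIV. l $ i * matrix_poly A h p $ i) = 0" for p
  proof (induction p)
    case (pCons a p)
    have "(\<Sum>i\<in>UNIV. l $ i * (a * h $ i)) = a * (\<Sum>i\<in>UNIV. l $ i * h $ i)"
      by (simp add: sum_distrib_left mult_ac)
    with pCons show ?case
      by (simp add: distrib_left sum.distrib left h)
  qed simp
  define P where "P n \<longleftrightarrow> (\<exists>p. p \<noteq> 0 \<and> degree p = n \<and> matrix_poly A h p = 0)" for n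
  have "\<exists>n. P n" using ex_annihilating_poly[of A h] by (auto simp: P_def)
  then have "P (LEAST n. P n)" by (rule LeastI_ex)
  then obtain p where p: "p \<noteq> 0" "degree p = (LEAST n. P n)" "matrix_poly A h p = 0"
    by (auto simp: P_def)
  have "cmod z < 1" if z: "poly p z = 0" for z
  proof -
    obtain q where q: "p = [:- z, 1:] * q"
      using z by (auto simp: poly_eq_0_iff_dvd)
    then have "q \<noteq> 0" using p by auto
    then have "degree q < degree p" unfolding q by (simp add: degree_linear_factor del: mult_pCons_left)
    then have "\<not> P (degree q)" using p not_less_Least by metis
    then have "matrix_poly A h q \<noteq> 0" using \<open>q \<noteq> 0\<close> by (auto simp: P_def)
    moreover have "A *v matrix_poly A h q = z *s matrix_poly A h q"
      using p(3) unfolding q matrix_poly_linear_factor by simp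
    ultimately show ?thesis using small inv by blast
  qed
  moreover have "((*v) A ^^ n) 0 = 0" for n
    by (induction n) simp_all
  ultimately show ?thesis
    using p by (intro summable_orbit_matrix_poly[of p A h]) (auto simp: p(3))
qed

section \<open>Eigenvalues of the substitution matrix\<close>

lemma int_poly_eval_hom:
  fixes z :: "'b :: {comm_ring_1, ring_char_0}"
  defines "E \<equiv> \<lambda>p. poly (map_poly of_int p) z"
  shows "E (p + q) = E p + E q" "E (p * q) = E p * E q"
    "E (\<Sum>i\<in>I. f i) = (\<Sum>i\<in>I. E (f i))" "E (\<Prod>i\<in>I. f i) = (\<Prod>i\<in>I. E (f i))"
proof -
  have pC: "E (pCons a p) = of_int a + z * E p" for a p
    by (simp add: E_def map_poly_pCons)
  have zero: "E 0 = 0" and one: "E 1 = 1" by (simp_all add: E_def)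
  show add: "E (p + q) = E p + E q" for p q
    by (induction p q rule: poly_induct2) (simp_all add: pC zero algebra_simps)
  have smult: "E (smult c q) = of_int c * E q" for c q
    by (induction q) (simp_all add: pC zero algebra_simps)
  show mult: "E (p * q) = E p * E q" for p q
    by (induction p) (simp_all add: pC zero add smult algebra_simps)
  show "E (\<Sum>i\<in>I. f i) = (\<Sum>i\<in>I. E (f i))"
    by (induction I rule: infinite_finite_induct) (simp_all add: zero add)
  show "E (\<Prod>i\<in>I. f i) = (\<Prod>i\<in>I. E (f i))"
    by (induction I rule: infinite_finite_induct) (simp_all add: one mult)
qed

lemma charpoly_eigenvalue:
  fixes M :: "int ^ 'n ^ 'n" and z :: "'b::field_char_0"
  assumes "y \<noteq> 0" "map_matrix of_int M *v y = z *s y"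
  shows "poly (map_poly of_int (charpoly M)) z = 0"
proof -
  define B :: "'b ^ 'n ^ 'n" where "B = (\<chi> i j. (if i = j then z else 0) - of_int (M $ i $ j))"
  have "B *v y = 0"
  proof (simp add: vec_eq_iff, intro allI)
    fix i
    have "(B *v y) $ i = (\<Sum>j\<in>UNIV. (if i = j then z * y $ j else 0) - of_int (M $ i $ j) * y $ j)"
      unfolding matrix_vector_mult_def B_def vec_lambda_beta by (intro sum.cong) (auto simp: algebra_simps)
    also have "\<dots> = z * y $ i - (map_matrix of_int M *v y) $ i"
      by (simp add: sum_subtractf matrix_vector_mult_def)
    finally show "(B *v y) $ i = 0" using assms(2) by simp
  qed
  then have "\<not> invertible B"
    using assms(1) matrix_left_invertible_ker[of B] invertible_left_inverse[of B] by blast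
  then have "det B = 0"
    by (simp add: invertible_det_nz)
  moreover have "poly (map_poly of_int (charpoly M)) z = det B"
  proof -
    have sgn: "poly (map_poly of_int (of_int k)) z = of_int k" for k :: int
      by (simp add: of_int_poly map_poly_pCons)
    have entry: "poly (map_poly of_int ((if i = j then [:0, 1:] else 0) - [:M $ i $ j:])) z = B $ i $ j" for i j
      by (simp add: B_def map_poly_pCons)
    show ?thesis
      unfolding charpoly_def det_def
      by (simp only: int_poly_eval_hom sgn vec_lambda_beta entry)
  qed
  ultimately show ?thesis by simp
qed

text \<open>
  Let \<open>g\<close> be a nonzero integer polynomial of least degree vanishing at \<open>x\<close>. By pseudo-division and
  because irreducible integer polynomials are prime, \<open>g\<close> is a constant multiple of both \<open>p\<close> and \<open>q\<close>, so these
  have the same complex zeros.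
\<close>

lemma irreducible_int_polys_common_zero:
  fixes p q :: "int poly" and x :: real and z :: complex
  assumes irr: "irreducible p" "irreducible q"
    and x: "poly (map_poly of_int p) x = 0" "poly (map_poly of_int q) x = 0"
    and z: "poly (map_poly of_int p) z = 0"
  shows "poly (map_poly of_int q) z = 0"
proof -
  define V where "V f \<longleftrightarrow> f \<noteq> 0 \<and> poly (map_poly of_int f) x = 0" for f :: "int poly"
  have "V p" using irr x by (auto simp: V_def)
  then obtain g where g: "V g" and min: "\<And>f. V f \<Longrightarrow> degree g \<le> degree f"
    using ex_has_least_nat[of V p degree] by blast
  have no_const: "f = 0" if "degree f = 0" "poly (map_poly of_int f) x = 0" for f :: "int poly"
    using that by (elim degree_eq_zeroE) (simp add: map_poly_pCons)
  have main: "\<exists>s. s \<noteq> 0 \<and> g = smult s f" if "irreducible f" "poly (map_poly of_int f) x = 0" for f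
  proof -
    have "f \<noteq> 0" using that by auto
    have "g \<noteq> 0" using g by (auto simp: V_def)
    obtain a u where a: "a \<noteq> 0" and au: "smult a f = g * u + pseudo_mod f g"
      using pseudo_mod(1)[OF \<open>g \<noteq> 0\<close>] by blast
    have "poly (map_poly of_int (pseudo_mod f g)) x = 0"
    proof -
      have "poly (map_poly of_int (smult a f)) x = 0"
        using int_poly_eval_hom(2)[of "[:a:]" f x] that by simp
      then show ?thesis
        using g unfolding au by (simp add: int_poly_eval_hom V_def)
    qed
    then have "pseudo_mod f g = 0"
      using pseudo_mod(2)[OF \<open>g \<noteq> 0\<close>, of f] min[of "pseudo_mod f g"] by (fastforce simp: V_def)
    then have eq: "smult a f = g * u" using au by simp
    have "prime_elem f" using that by (simp add: prime_elem_iff_irreducible)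
    moreover have "f dvd g * u" unfolding eq[symmetric] by (simp add: dvd_smult)
    ultimately consider "f dvd g" | "f dvd u" by (auto simp: prime_elem_dvd_mult_iff)
    then have "f dvd g"
    proof cases
      case 2
      then obtain u' where "u = f * u'" by (auto elim: dvdE)
      then have "f * [:a:] = f * (g * u')" using eq by (simp add: mult_ac)
      then have "[:a:] = g * u'" using \<open>f \<noteq> 0\<close> by (metis mult_left_cancel)
      moreover from this have "u' \<noteq> 0" using a by auto
      ultimately have "degree g = 0"
        using degree_mult_eq[OF \<open>g \<noteq> 0\<close>, of u'] by (metis add_is_0 degree_pCons_0)
      then show ?thesis using no_const g by (auto simp: V_def)
    qed
    then obtain s where s: "g = f * s" by (auto elim: dvdE)
    then have "f \<noteq> 0" "s \<noteq> 0" using \<open>g \<noteq> 0\<close> by auto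
    then have "degree s = 0"
      using min[of f] that degree_mult_eq[of f s] s by (auto simp: V_def)
    then obtain c where "s = [:c:]" by (elim degree_eq_zeroE)
    with s \<open>s \<noteq> 0\<close> show ?thesis by (intro exI[of _ c]) (simp add: mult_ac)
  qed
  have ev_smult: "poly (map_poly of_int (smult c f)) z = of_int c * poly (map_poly of_int f) z" for c f
    using int_poly_eval_hom(2)[of "[:c:]" f z] by (simp add: map_poly_pCons)
  obtain s t where "s \<noteq> 0" "g = smult s p" "t \<noteq> 0" "g = smult t q"
    using main[OF irr(1) x(1)] main[OF irr(2) x(2)] by blast
  then show ?thesis
    using z ev_smult[of s p] ev_smult[of t q] by auto
qed


lemma funpow_matrix_of_int:
  fixes M :: "int ^ 'n ^ 'n"
  shows "map_matrix real_of_int (((**) M ^^ n) (mat 1)) *v v = ((*v) (map_matrix real_of_int M) ^^ n) v"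
proof (induction n)
  case 0
  have "map_matrix real_of_int (mat 1 :: int ^ 'n ^ 'n) = mat 1"
    by (simp add: vec_eq_iff mat_def)
  then show ?case by simp
next
  case (Suc n)
  have "map_matrix real_of_int (M ** X) = map_matrix real_of_int M ** map_matrix real_of_int X"
    for X :: "int ^ 'n ^ 'n"
    by (simp add: vec_eq_iff matrix_matrix_mult_def)
  then show ?case
    by (simp add: matrix_vector_mul_assoc[symmetric] Suc)
qed

lemma nonneg_orthogonal_to_positive:
  assumes "\<And>i. 0 < L $ i" "\<And>i. 0 \<le> h $ i" "L \<bullet> h = 0"
  shows "h = (0 :: real ^ 'n)"
proof -
  have "\<forall>i\<in>UNIV. L $ i * h $ i = 0"
    using assms by (subst sum_nonneg_eq_0_iff[symmetric]) (auto simp: inner_vec_def less_imp_le)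
  then show ?thesis using assms(1) by (simp add: vec_eq_iff) (metis less_irrefl)
qed

text \<open>
  If \<open>h\<close> is an eigenvector, then so is its vector of absolute values, because \<open>L\<close> turns the
  entrywise inequality \<open>lam |h| \<le> A |h|\<close> into an equality. Hence the vectors \<open>|h| + h\<close> and
  \<open>|h| - h\<close> are non-negative eigenvectors, and a non-negative eigenvector of a primitive matrix
  has either all or none of its entries positive; so \<open>h\<close> has constant sign.
\<close>

lemma pf_eigenvector_in_hyperplane_eq_0:
  fixes M :: "int ^ 'n ^ 'n"
  defines "A \<equiv> map_matrix real_of_int M"
  assumes nonneg: "\<And>i j. 0 \<le> M $ i $ j" and prim: "primitive_matrix M"
    and L: "\<And>i. 0 < L $ i" "L v* A = lam *\<^sub>R L" and lam: "0 < lam"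
    and h: "A *v h = lam *\<^sub>R h" "L \<bullet> h = 0"
  shows "h = 0"
proof -
  define g where "g = (\<chi> i. \<bar>h $ i\<bar>)"
  define d where "d = A *v g - lam *\<^sub>R g"
  have "0 \<le> d $ i" for i
  proof -
    have "lam * g $ i = \<bar>(A *v h) $ i\<bar>"
      using lam by (simp add: h g_def abs_mult)
    also have "\<dots> \<le> (\<Sum>j\<in>UNIV. \<bar>A $ i $ j * h $ j\<bar>)"
      by (simp add: matrix_vector_mult_def)
    also have "\<dots> = (A *v g) $ i"
      using nonneg by (simp add: matrix_vector_mult_def g_def A_def abs_mult)
    finally show ?thesis by (simp add: d_def)
  qed
  moreover have "L \<bullet> d = 0"
    using L(2) by (simp add: d_def inner_diff_right flip: dot_lmul_matrix)
  ultimately have "d = 0" using L(1) nonneg_orthogonal_to_positive by blast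
  then have g: "A *v g = lam *\<^sub>R g" by (simp add: d_def)
  obtain n where n: "\<And>i j. 0 < (((**) M ^^ n) (mat 1)) $ i $ j"
    using prim by (auto simp: primitive_matrix_def)
  have pos: "0 < v $ i" if v: "A *v v = lam *\<^sub>R v" "\<And>j. 0 \<le> v $ j" "v \<noteq> 0" for v i
  proof -
    define P where "P = map_matrix real_of_int (((**) M ^^ n) (mat 1))"
    obtain j where j: "0 < v $ j" using v by (auto simp: vec_eq_iff less_le)
    have "((*v) A ^^ k) v = lam ^ k *\<^sub>R v" for k
      by (induction k) (simp_all add: v scaleR_matrix_vector_assoc[symmetric] matrix_vector_mult_scaleR)
    then have "P *v v = lam ^ n *\<^sub>R v"
      by (simp add: P_def funpow_matrix_of_int A_def)
    then have "lam ^ n * v $ i = (\<Sum>k\<in>UNIV. P $ i $ k * v $ k)"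
      by (simp add: matrix_vector_mult_def vec_eq_iff)
    also have "\<dots> > 0"
      using n j v by (intro sum_pos2[of _ j]) (auto simp: P_def less_imp_le)
    finally show ?thesis using lam by (simp add: zero_less_mult_iff)
  qed
  have "g + h = 0 \<or> g - h = 0"
  proof (rule ccontr)
    assume "\<not> ?thesis"
    then have "0 < (g + h) $ i \<and> 0 < (g - h) $ i" for i
      using pos[of "g + h" i] pos[of "g - h" i] g h
      by (auto simp: matrix_vector_right_distrib matrix_vector_mult_diff_distrib scaleR_add_right
          scaleR_diff_right g_def)
    \<comment> \<open>Any index gives the contradiction \<open>|h\<^sub>i| > |h\<^sub>i|\<close>.\<close>
    from this[of undefined] show False by (auto simp: g_def abs_if split: if_splits)
  qed
  then have "(\<forall>i. 0 \<le> (- h) $ i) \<or> (\<forall>i. 0 \<le> h $ i)"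
  proof
    assume "g + h = 0"
    then have "(g + h) $ i = 0" for i by simp
    then have *: "\<bar>h $ i\<bar> + h $ i = 0" for i by (simp add: g_def)
    have "h $ i \<le> 0" for i using *[of i] by linarith
    then show ?thesis by simp
  next
    assume "g - h = 0"
    then have "(g - h) $ i = 0" for i by simp
    then have *: "\<bar>h $ i\<bar> - h $ i = 0" for i by (simp add: g_def)
    have "0 \<le> h $ i" for i using *[of i] by linarith
    then show ?thesis by simp
  qed
  moreover have "L \<bullet> (- h) = 0" using h by simp
  ultimately have "- h = 0 \<or> h = 0"
    using nonneg_orthogonal_to_positive[OF L(1), of h] nonneg_orthogonal_to_positive[OF L(1), of "- h"] h(2)
    by blast
  then show ?thesis by simp
qed

text \<open>
  The characteristic polynomial and the minimal polynomial of the Pisot number \<open>lam\<close> share the zero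
  \<open>lam\<close>, so every eigenvalue of \<open>A\<close> is a conjugate of \<open>lam\<close>. All of these except \<open>lam\<close> itself lie in
  the open unit disc, and \<open>lam\<close> has no eigenvector in the hyperplane.
\<close>

lemma summable_orbit_in_hyperplane:
  fixes M :: "int ^ 'n ^ 'n"
  defines "A \<equiv> map_matrix real_of_int M"
  assumes nonneg: "\<And>i j. 0 \<le> M $ i $ j" and prim: "primitive_matrix M"
    and irr: "irreducible (charpoly M)" and pisot: "pisot_number lam"
    and lam: "pf_eigenvalue A lam"
    and L: "\<And>i. 0 < L $ i" "L v* A = lam *\<^sub>R L"
    and h: "L \<bullet> h = 0"
  shows "summable (\<lambda>n. norm (((*v) A ^^ n) h))"
proof -
  let ?A = "map_matrix of_int M :: complex ^ 'n ^ 'n"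
  let ?c = "\<lambda>v :: real ^ 'n. \<chi> i. complex_of_real (v $ i)"
  have lam_pos: "0 < lam" using pisot by (simp add: pisot_number_def)
  obtain v where "v \<noteq> 0" "A *v v = lam *\<^sub>R v"
    using lam by (auto simp: pf_eigenvalue_def)
  then have root: "poly (map_poly of_int (charpoly M)) lam = 0"
    using charpoly_eigenvalue[of v M lam] by (simp add: A_def scalar_mult_eq_scaleR)
  obtain p :: "int poly" where p: "irreducible p" "poly (map_poly of_int p) lam = 0"
    "\<And>z :: complex. poly (map_poly of_int p) z = 0 \<Longrightarrow> z \<noteq> lam \<Longrightarrow> cmod z < 1"
    using pisot by (auto simp: pisot_number_def)
  have Ac: "?A *v ?c u = ?c (A *v u)" for u
    by (simp add: vec_eq_iff matrix_vector_mult_def A_def)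
  have "summable (\<lambda>n. norm (((*v) ?A ^^ n) (?c h)))"
  proof (rule summable_orbit_if_small_eigenvalues[where l = "?c L" and lam = lam])
    fix u
    have left: "(\<Sum>i\<in>UNIV. of_real (L $ i) * (of_int (M $ i $ j))) = complex_of_real (lam * L $ j)" for j
    proof -
      have "(\<Sum>i\<in>UNIV. L $ i * A $ i $ j) = lam * L $ j"
        using L(2) by (simp add: vec_eq_iff vector_matrix_mult_def mult.commute)
      then have "of_real (\<Sum>i\<in>UNIV. L $ i * A $ i $ j) = complex_of_real (lam * L $ j)" by simp
      then show ?thesis by (simp add: A_def)
    qed
    have "(\<Sum>i\<in>UNIV. ?c L $ i * (?A *v u) $ i) =
      (\<Sum>i\<in>UNIV. \<Sum>j\<in>UNIV. of_real (L $ i) * of_int (M $ i $ j) * u $ j)"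
      by (simp add: matrix_vector_mult_def sum_distrib_left mult_ac)
    also have "\<dots> = (\<Sum>j\<in>UNIV. (\<Sum>i\<in>UNIV. of_real (L $ i) * of_int (M $ i $ j)) * u $ j)"
      by (subst sum.swap) (simp add: sum_distrib_right)
    also have "\<dots> = lam * (\<Sum>i\<in>UNIV. ?c L $ i * u $ i)"
      by (simp add: left sum_distrib_left mult_ac)
    finally show "(\<Sum>i\<in>UNIV. ?c L $ i * (?A *v u) $ i) = lam * (\<Sum>i\<in>UNIV. ?c L $ i * u $ i)" .
  next
    fix y z
    assume y: "y \<noteq> 0" "(\<Sum>i\<in>UNIV. ?c L $ i * y $ i) = 0" "?A *v y = z *s y"
    have "poly (map_poly of_int p) z = 0"
      using irreducible_int_polys_common_zero[OF irr p(1) root p(2)] charpoly_eigenvalue[OF y(1,3)]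
      by simp
    moreover have "z \<noteq> lam"
    proof
      assume z: "z = lam"
      let ?re = "\<chi> i. Re (y $ i)" and ?im = "\<chi> i. Im (y $ i)"
      have "A *v ?re = lam *\<^sub>R ?re" "A *v ?im = lam *\<^sub>R ?im"
        using y(3) by (auto simp: vec_eq_iff matrix_vector_mult_def A_def complex_eq_iff z)
      moreover have "L \<bullet> ?re = 0" "L \<bullet> ?im = 0"
        using y(2) by (auto simp: inner_vec_def complex_eq_iff)
      ultimately have "?re = 0" "?im = 0"
        using pf_eigenvector_in_hyperplane_eq_0[OF nonneg prim L(1) L(2)[unfolded A_def] lam_pos]
        by (auto simp: A_def)
      then show False using y(1) by (simp add: vec_eq_iff complex_eq_iff)
    qed
    ultimately show "cmod z < 1" using p(3) by blast
  next
    have "complex_of_real (\<Sum>i\<in>UNIV. L $ i * h $ i) = 0"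
      using h by (simp add: inner_vec_def)
    then show "(\<Sum>i\<in>UNIV. ?c L $ i * ?c h $ i) = 0" by simp
  qed
  moreover have "((*v) ?A ^^ n) (?c h) = ?c (((*v) A ^^ n) h)" for n
    by (induction n) (simp_all add: Ac)
  moreover have "norm (?c u) = norm u" for u
    by (simp add: norm_vec_def)
  ultimately show ?thesis by simp
qed

section \<open>Abelianisations of inflation words\<close>

lemma parikh_Nil [simp]: "parikh [] = 0"
  by (simp add: parikh_def vec_eq_iff)

lemma parikh_append [simp]: "parikh (u @ v) = parikh u + parikh v"
  by (simp add: parikh_def vec_eq_iff)

lemma parikh_Cons: "parikh (a # u) = axis a 1 + parikh u"
  by (simp add: parikh_def vec_eq_iff axis_def)

lemma subst_matrix_eq_count_list:
  assumes "compatible \<theta>" "v \<in> set_pmf (\<theta> j)"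
  shows "subst_matrix \<theta> $ i $ j = of_nat (count_list v i)"
proof -
  have "count_list u i = count_list v i" if "u \<in> set_pmf (\<theta> j)" for u
  proof -
    have "parikh u = parikh v" using assms that unfolding compatible_def by blast
    then show ?thesis by (simp add: parikh_def vec_eq_iff)
  qed
  then have "(THE m. \<forall>v\<in>set_pmf (\<theta> j). count_list v i = m) = count_list v i"
    using assms(2) by (intro the_equality) (blast, metis)
  then show ?thesis by (simp add: subst_matrix_def)
qed

lemma parikh_subst_word:
  assumes "compatible \<theta>" "v \<in> set_pmf (subst_word \<theta> u)"
  shows "parikh v = subst_matrix \<theta> *v parikh u"
  using assms(2)
proof (induction u arbitrary: v)
  case (Cons a u)
  then obtain s t where v: "v = s @ t" "s \<in> set_pmf (\<theta> a)" "t \<in> set_pmf (subst_word \<theta> u)"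
    by auto
  have "parikh s = subst_matrix \<theta> *v axis a 1"
    using subst_matrix_eq_count_list[OF assms(1) v(2), where 'b = real]
    by (simp add: vec_eq_iff parikh_def matrix_vector_mult_basis column_def)
  then show ?case
    using Cons.IH[OF v(3)] by (simp add: v parikh_Cons matrix_vector_right_distrib)
qed simp

lemma parikh_subst_pow:
  assumes "compatible \<theta>" "v \<in> set_pmf (subst_pow \<theta> n u)"
  shows "parikh v = ((*v) (subst_matrix \<theta>) ^^ n) (parikh u)"
  using assms(2)
proof (induction n arbitrary: v)
  case (Suc n)
  then show ?case using parikh_subst_word[OF assms(1)] by auto
qed simp

definition image_prefixes :: "('a \<Rightarrow> 'a list pmf) \<Rightarrow> 'a list set" where
  "image_prefixes \<theta> = {s. \<exists>a. \<exists>v\<in>set_pmf (\<theta> a). prefix s v}"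

lemma finite_image_prefixes:
  assumes "random_substitution \<theta>"
  shows "finite (image_prefixes \<theta>)"
proof -
  have "image_prefixes \<theta> = (\<Union>a. \<Union>v\<in>set_pmf (\<theta> a). set (prefixes v))"
    unfolding image_prefixes_def by (simp add: set_eq_iff)
  then show ?thesis
    using assms by (auto simp: random_substitution_def)
qed

lemma parikh_prefix_subst_word:
  assumes "compatible \<theta>" "v \<in> set_pmf (subst_word \<theta> u)" "prefix q v"
  shows "\<exists>u' s. prefix u' u \<and> s \<in> image_prefixes \<theta> \<and>
           parikh q = subst_matrix \<theta> *v parikh u' + parikh s"
  using assms(2,3)
proof (induction u arbitrary: v q)
  case Nil
  \<comment> \<open>The empty word is a prefix of an image of any letter.\<close>
  obtain s where "s \<in> set_pmf (\<theta> undefined)" by (meson all_not_in_conv set_pmf_not_empty)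
  then have "[] \<in> image_prefixes \<theta>" by (auto simp: image_prefixes_def)
  then show ?case using Nil by (intro exI[of _ "[]"]) auto
next
  case (Cons a u)
  then obtain v1 v2 where v: "v = v1 @ v2" "v1 \<in> set_pmf (\<theta> a)" "v2 \<in> set_pmf (subst_word \<theta> u)"
    by auto
  from Cons.prems(2) v(1) consider "prefix q v1" | q2 where "q = v1 @ q2" "prefix q2 v2"
    by (auto simp: prefix_append)
  then show ?case
  proof cases
    case 1
    then have "q \<in> image_prefixes \<theta>" using v(2) by (auto simp: image_prefixes_def)
    then show ?thesis by (intro exI[of _ "[]"] exI[of _ q]) auto
  next
    case 2
    obtain u' s where "prefix u' u" "s \<in> image_prefixes \<theta>"
      "parikh q2 = subst_matrix \<theta> *v parikh u' + parikh s"
      using Cons.IH[OF v(3) 2(2)] by blast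
    moreover have "v1 \<in> set_pmf (subst_word \<theta> [a])"
      using v(2) by simp
    ultimately show ?thesis
      using parikh_subst_word[OF assms(1), of v1 "[a]"] 2(1)
      by (intro exI[of _ "a # u'"] exI[of _ s])
         (auto simp: parikh_Cons matrix_vector_right_distrib)
  qed
qed

section \<open>Boundedness of the Rauzy fractal\<close>

lemma rauzy_point_Nil [simp]: "rauzy_point L R [] = 0"
  by (simp add: rauzy_point_def hyp_proj_def)

lemma hyp_proj_add: "hyp_proj L R (u + v) = hyp_proj L R u + hyp_proj L R v"
  by (simp add: hyp_proj_def inner_add_right scaleR_add_left)

lemma rauzy_point_append: "rauzy_point L R (u @ v) = rauzy_point L R u + rauzy_point L R v"
  by (simp add: rauzy_point_def hyp_proj_add)

lemma hyp_proj_matrix_commute: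
  assumes "L v* M = lam *\<^sub>R L" "M *v R = lam *\<^sub>R R"
  shows "hyp_proj L R (M *v v) = M *v hyp_proj L R v"
proof -
  have "L \<bullet> (M *v v) = lam * (L \<bullet> v)"
    using assms(1) by (simp flip: dot_lmul_matrix)
  then show ?thesis
    by (simp add: hyp_proj_def matrix_vector_mult_diff_distrib matrix_vector_mult_scaleR assms(2)
        mult.commute)
qed

lemma pf_eigenvalue_unique:
  fixes M :: "real ^ 'n ^ 'n"
  assumes "pf_eigenvalue M a" "pf_eigenvalue M b"
  shows "a = b"
proof -
  have le: "c \<le> e" if c: "pf_eigenvalue M c" and e: "pf_eigenvalue M e" for c e
  proof -
    obtain v where v: "v \<noteq> 0" "M *v v = c *\<^sub>R v" using c by (auto simp: pf_eigenvalue_def)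
    define w where "w = (\<chi> i. complex_of_real (v $ i))"
    have "w \<noteq> 0" using v(1) by (auto simp: w_def vec_eq_iff)
    moreover have "(\<Sum>j\<in>UNIV. M $ i $ j * v $ j) = c * v $ i" for i
      using v(2) by (simp add: vec_eq_iff matrix_vector_mult_def)
    then have "complex_of_real (\<Sum>j\<in>UNIV. M $ i $ j * v $ j) = of_real (c * v $ i)" for i
      by simp
    then have "map_matrix complex_of_real M *v w = complex_of_real c *s w"
      by (simp add: vec_eq_iff matrix_vector_mult_def w_def)
    ultimately have "cmod (complex_of_real c) \<le> e"
      using e unfolding pf_eigenvalue_def by blast
    then show ?thesis by simp
  qed
  show ?thesis using le[OF assms] le[OF assms(2,1)] by simp
qed

lemma summable_substitution_orbit:
  assumes "irreducible_pisot \<theta>" "pf_eigenvectors (subst_matrix \<theta>) L R" "L \<bullet> h = 0"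
  shows "summable (\<lambda>n. norm (((*v) (subst_matrix \<theta>) ^^ n) h))"
proof -
  have eq: "subst_matrix \<theta> = map_matrix real_of_int (subst_matrix \<theta>)"
    by (simp add: subst_matrix_def vec_eq_iff)
  obtain lam where lam: "pf_eigenvalue (subst_matrix \<theta>) lam" "pisot_number lam"
    using assms by (auto simp: irreducible_pisot_def)
  obtain lam' where lam': "pf_eigenvalue (subst_matrix \<theta>) lam'" "L v* subst_matrix \<theta> = lam' *\<^sub>R L"
    "subst_matrix \<theta> *v R = lam' *\<^sub>R R" and L: "\<And>i. 0 < L $ i"
    using assms(2) by (auto simp: pf_eigenvectors_def)
  have lam_eq: "lam' = lam" using pf_eigenvalue_unique lam(1) lam'(1) by blast
  show ?thesis
    unfolding eq
  proof (rule summable_orbit_in_hyperplane)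
    show "0 \<le> (subst_matrix \<theta> :: int ^ 'a ^ 'a) $ i $ j" for i j
      by (simp add: subst_matrix_def)
    show "primitive_matrix (subst_matrix \<theta>)" "irreducible (charpoly (subst_matrix \<theta>))"
      using assms(1) by (auto simp: irreducible_pisot_def primitive_substitution_def)
    show "L v* map_matrix real_of_int (subst_matrix \<theta>) = lam *\<^sub>R L"
      "pf_eigenvalue (map_matrix real_of_int (subst_matrix \<theta>)) lam"
      using lam' lam_eq eq by simp_all
  qed (use L lam assms in auto)
qed

text \<open>
  A prefix of an inflation word of level \<open>k + 1\<close> is the inflation of a prefix of level \<open>k\<close> followed
  by a prefix of the image of one letter. Unfolding this recursion writes the projected
  abelianisation of every prefix as a sum of vectors \<open>M\<^sup>j h\<^sub>j\<close> with the \<open>h\<^sub>j\<close> from one finite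
  subset of the hyperplane, and such sums are bounded because \<open>M\<close> contracts the hyperplane.
\<close>

lemma rauzy_points_of_prefixes_bounded:
  assumes "random_substitution \<theta>" "compatible \<theta>" "irreducible_pisot \<theta>"
    and pf: "pf_eigenvectors (subst_matrix \<theta>) L R"
  shows "\<exists>C. \<forall>k a. \<forall>v\<in>set_pmf (subst_pow \<theta> k [a]). \<forall>q. prefix q v \<longrightarrow> norm (rauzy_point L R q) \<le> C"
proof -
  let ?M = "subst_matrix \<theta> :: real ^ 'a ^ 'a"
  \<comment> \<open>The single letters are the non-empty prefixes of the words of level \<open>0\<close>.\<close>
  define F where "F = insert [] (image_prefixes \<theta> \<union> range (\<lambda>a. [a]))"
  define c where "c i = (\<Sum>s\<in>F. norm (((*v) ?M ^^ i) (rauzy_point L R s)))" for i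
  obtain lam where lam: "L v* ?M = lam *\<^sub>R L" "?M *v R = lam *\<^sub>R R"
    using pf by (auto simp: pf_eigenvectors_def)
  have fin: "finite F"
    using finite_image_prefixes[OF assms(1)] by (simp add: F_def)
  have c0: "0 \<le> c i" for i by (simp add: c_def sum_nonneg)
  have "L \<bullet> rauzy_point L R s = 0" for s
    using pf by (simp add: rauzy_point_def hyp_proj_def inner_diff_right pf_eigenvectors_def)
  then have sc: "summable c"
    unfolding c_def using summable_substitution_orbit[OF assms(3) pf] by (intro summable_sum) auto
  have cF: "norm (((*v) ?M ^^ i) (rauzy_point L R s)) \<le> c i" if "s \<in> F" for s i
    unfolding c_def using fin that by (intro member_le_sum) auto
  have tail: "(\<Sum>i. c (i + j)) = c j + (\<Sum>i. c (i + Suc j))" for j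
    using suminf_split_head[of "\<lambda>i. c (i + j)"] sc by (simp add: summable_ignore_initial_segment)
  have tail0: "0 \<le> (\<Sum>i. c (i + j))" for j
    using sc c0 by (intro suminf_nonneg) (auto simp: summable_ignore_initial_segment)
  \<comment> \<open>Each unfolding of the recursion multiplies by \<open>M\<close> once more, hence the power \<open>j\<close> and the tail.\<close>
  have *: "norm (((*v) ?M ^^ j) (rauzy_point L R q)) \<le> (\<Sum>i. c (i + j))"
    if "v \<in> set_pmf (subst_pow \<theta> k [a])" "prefix q v" for k a v q j
    using that
  proof (induction k arbitrary: v q j)
    case 0
    then have "q \<in> F" by (auto simp: F_def prefix_Cons)
    then have "norm (((*v) ?M ^^ j) (rauzy_point L R q)) \<le> c j" by (rule cF)
    also have "\<dots> \<le> (\<Sum>i. c (i + j))" using tail[of j] tail0[of "Suc j"] by linarith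
    finally show ?case .
  next
    case (Suc k)
    then obtain v' where v': "v' \<in> set_pmf (subst_pow \<theta> k [a])" "v \<in> set_pmf (subst_word \<theta> v')"
      by auto
    then obtain u' s where u': "prefix u' v'" "s \<in> image_prefixes \<theta>"
      "parikh q = ?M *v parikh u' + parikh s"
      using parikh_prefix_subst_word[OF assms(2) _ Suc.prems(2)] by blast
    have "rauzy_point L R q = ?M *v rauzy_point L R u' + rauzy_point L R s"
      unfolding rauzy_point_def u'(3) hyp_proj_add hyp_proj_matrix_commute[OF lam] by simp
    moreover have "((*v) ?M ^^ j) (x + y) = ((*v) ?M ^^ j) x + ((*v) ?M ^^ j) y" for x y
      by (induction j) (simp_all add: matrix_vector_right_distrib)
    ultimately have "norm (((*v) ?M ^^ j) (rauzy_point L R q)) \<le>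
      norm (((*v) ?M ^^ Suc j) (rauzy_point L R u')) + norm (((*v) ?M ^^ j) (rauzy_point L R s))"
      by (simp add: funpow_swap1 norm_triangle_ineq)
    also have "\<dots> \<le> (\<Sum>i. c (i + Suc j)) + c j"
      using u' by (intro add_mono Suc.IH[OF v'(1)] cF) (auto simp: F_def)
    finally show ?case using tail[of j] by simp
  qed
  show ?thesis
    using *[where j = 0] by (intro exI[of _ "\<Sum>i. c i"]) auto
qed

lemma rauzy_points_of_subshift_bounded:
  assumes "random_substitution \<theta>" "compatible \<theta>" "irreducible_pisot \<theta>"
    and "pf_eigenvectors (subst_matrix \<theta>) L R" and x: "x \<in> subshift \<theta>"
  shows "bounded (range (\<lambda>n. rauzy_point L R (seq_take n x)))"
proof -
  obtain C where C: "\<And>k a v q. v \<in> set_pmf (subst_pow \<theta> k [a]) \<Longrightarrow> prefix q v \<Longrightarrow>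
    norm (rauzy_point L R q) \<le> C"
    using rauzy_points_of_prefixes_bounded[OF assms(1-4)] by blast
  have "norm (rauzy_point L R (seq_take n x)) \<le> C + C" for n
  proof -
    obtain a k v where v: "v \<in> set_pmf (subst_pow \<theta> k [a])" "sublist (seq_take n x) v"
      using x unfolding subshift_def seq_take_def by blast
    then obtain s t where st: "v = s @ seq_take n x @ t" by (auto simp: sublist_def)
    have "norm (rauzy_point L R (s @ seq_take n x)) \<le> C" "norm (rauzy_point L R s) \<le> C"
      using C[OF v(1)] by (auto simp: st prefix_def)
    moreover have "rauzy_point L R (seq_take n x) =
      rauzy_point L R (s @ seq_take n x) - rauzy_point L R s"
      by (simp add: rauzy_point_append)
    ultimately show ?thesis
      by (metis add_mono norm_triangle_ineq4 order_trans)
  qed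
  then show ?thesis by (auto simp: bounded_iff)
qed

section \<open>Sequences\<close>

lemma funpow_lshift: "(lshift ^^ n) x = (\<lambda>k. x (n + k))"
  by (induction n) (auto simp: lshift_def fun_eq_iff)

lemma funpow_lshift_add: "(lshift ^^ m) ((lshift ^^ n) x) = (lshift ^^ (m + n)) x"
  by (simp add: funpow_add)

lemma length_seq_take [simp]: "length (seq_take n x) = n"
  by (simp add: seq_take_def)

lemma seq_take_eq_iff: "seq_take n x = seq_take n y \<longleftrightarrow> (\<forall>k<n. x k = y k)"
  by (auto simp: seq_take_def)

lemma seq_take_mono: "seq_take n x = seq_take n y \<Longrightarrow> m \<le> n \<Longrightarrow> seq_take m x = seq_take m y"
  by (simp add: seq_take_eq_iff)

lemma seq_take_add: "seq_take (m + n) x = seq_take m x @ seq_take n ((lshift ^^ m) x)"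
  by (auto simp: seq_take_def funpow_lshift list_eq_iff_nth_eq nth_append)

lemma mem_cylinder_seq_take: "y \<in> cylinder (seq_take m x) \<longleftrightarrow> seq_take m y = seq_take m x"
  by (simp add: cylinder_def)

lemma topspace_seq_top [simp]: "topspace seq_top = UNIV"
  by (simp add: seq_top_def)

lemma openin_seq_top:
  "openin seq_top T \<longleftrightarrow> (\<forall>x\<in>T. \<exists>m. \<forall>y. seq_take m y = seq_take m x \<longrightarrow> y \<in> T)"
proof
  assume T: "openin seq_top T"
  show "\<forall>x\<in>T. \<exists>m. \<forall>y. seq_take m y = seq_take m x \<longrightarrow> y \<in> T"
  proof
    fix x assume "x \<in> T"
    then obtain U where U: "finite {i. U i \<noteq> UNIV}" "x \<in> Pi\<^sub>E UNIV U" "Pi\<^sub>E UNIV U \<subseteq> T"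
      using T unfolding seq_top_def openin_product_topology_alt by auto
    then obtain m where "{i. U i \<noteq> UNIV} \<subseteq> {..<m}"
      using finite_nat_iff_bounded by blast
    then have m: "U i \<noteq> UNIV \<Longrightarrow> i < m" for i by auto
    have "y \<in> T" if "seq_take m y = seq_take m x" for y
    proof -
      have "y i \<in> U i" for i
        using that m[of i] U(2) by (cases "U i = UNIV") (auto simp: seq_take_eq_iff)
      then show ?thesis using U(3) by auto
    qed
    then show "\<exists>m. \<forall>y. seq_take m y = seq_take m x \<longrightarrow> y \<in> T" by blast
  qed
next
  assume *: "\<forall>x\<in>T. \<exists>m. \<forall>y. seq_take m y = seq_take m x \<longrightarrow> y \<in> T"
  show "openin seq_top T"
    unfolding seq_top_def openin_product_topology_alt
  proof
    fix x assume "x \<in> T"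
    then obtain m where m: "\<And>y. seq_take m y = seq_take m x \<Longrightarrow> y \<in> T" using * by blast
    define U where "U i = (if i < m then {x i} else UNIV)" for i
    have "{i. U i \<noteq> UNIV} \<subseteq> {..<m}" by (auto simp: U_def)
    then have "finite {i. U i \<noteq> UNIV}" by (rule finite_subset) simp
    moreover have "y \<in> T" if y: "y \<in> Pi\<^sub>E UNIV U" for y
    proof -
      have "y i = x i" if "i < m" for i
        using PiE_mem[OF y, of i] that by (simp add: U_def)
      then show ?thesis by (intro m) (simp add: seq_take_eq_iff)
    qed
    ultimately show "\<exists>U. finite {i \<in> UNIV. U i \<noteq> topspace (discrete_topology UNIV)} \<and>
        (\<forall>i\<in>UNIV. openin (discrete_topology UNIV) (U i)) \<and> x \<in> Pi\<^sub>E UNIV U \<and> Pi\<^sub>E UNIV U \<subseteq> T"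
      by (intro exI[of _ U]) (auto simp: U_def)
  qed
qed

lemma in_closure_of_seq_top:
  "x \<in> seq_top closure_of A \<longleftrightarrow> (\<forall>m. \<exists>a\<in>A. seq_take m a = seq_take m x)"
proof
  assume x: "x \<in> seq_top closure_of A"
  show "\<forall>m. \<exists>a\<in>A. seq_take m a = seq_take m x"
  proof
    fix m
    have "openin seq_top (cylinder (seq_take m x))"
      unfolding openin_seq_top by (intro ballI exI[of _ m]) (simp add: mem_cylinder_seq_take)
    moreover have "x \<in> cylinder (seq_take m x)" by (simp add: mem_cylinder_seq_take)
    ultimately obtain a where "a \<in> A" "a \<in> cylinder (seq_take m x)"
      using x unfolding in_closure_of by blast
    then show "\<exists>a\<in>A. seq_take m a = seq_take m x" by (auto simp: mem_cylinder_seq_take)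
  qed
next
  assume "\<forall>m. \<exists>a\<in>A. seq_take m a = seq_take m x"
  then show "x \<in> seq_top closure_of A"
    unfolding in_closure_of openin_seq_top topspace_seq_top by (metis UNIV_I)
qed

lemma subshift_dense_iff:
  "x \<in> subshift_dense \<theta> \<longleftrightarrow>
     x \<in> subshift \<theta> \<and> (\<forall>y\<in>subshift \<theta>. \<forall>m. \<exists>n. seq_take m ((lshift ^^ n) x) = seq_take m y)"
  unfolding subshift_dense_def by (auto simp: in_closure_of_seq_top subset_iff)

section \<open>Translates of the Rauzy fractal\<close>

lemma bounded_translate_eq_0:
  fixes K :: "'b::real_normed_vector set"
  assumes "bounded K" "K \<noteq> {}" "\<And>x. x \<in> K \<Longrightarrow> x + t \<in> K"
  shows "t = 0"
proof (rule ccontr)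
  assume "t \<noteq> 0"
  obtain C where C: "\<And>x. x \<in> K \<Longrightarrow> norm x \<le> C" using assms(1) by (auto simp: bounded_iff)
  obtain x where x: "x \<in> K" using assms(2) by blast
  have iter: "x + real n *\<^sub>R t \<in> K" for n
  proof (induction n)
    case (Suc n)
    have "x + real (Suc n) *\<^sub>R t = (x + real n *\<^sub>R t) + t" by (simp add: algebra_simps)
    with assms(3)[OF Suc] show ?case by (simp only:)
  qed (use x in simp)
  obtain n where n: "(C + C) / norm t < real n" using reals_Archimedean2 by blast
  have "real n * norm t = norm ((x + real n *\<^sub>R t) - x)" by simp
  also have "\<dots> \<le> C + C" by (meson C iter x add_mono norm_triangle_ineq4 order_trans)
  finally show False using n \<open>t \<noteq> 0\<close> by (simp add: field_simps)
qed

definition seq_point :: "real ^ 'a \<Rightarrow> real ^ 'a \<Rightarrow> (nat \<Rightarrow> 'a::finite) \<Rightarrow> nat \<Rightarrow> real ^ 'a" where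
  "seq_point L R x n = rauzy_point L R (seq_take n x)"

lemma seq_point_0 [simp]: "seq_point L R x 0 = 0"
  by (simp add: seq_point_def seq_take_def)

lemma seq_point_add: "seq_point L R x (m + n) = seq_point L R x m + seq_point L R ((lshift ^^ m) x) n"
  by (simp add: seq_point_def seq_take_add rauzy_point_append)

lemma seq_point_cong: "seq_take m x = seq_take m y \<Longrightarrow> n \<le> m \<Longrightarrow> seq_point L R x n = seq_point L R y n"
  unfolding seq_point_def by (metis seq_take_mono)

lemma rauzy_set_eq: "rauzy_set L R x = closure (range (seq_point L R x))"
proof -
  have "{rauzy_point L R (seq_take n x) |n. True} = range (seq_point L R x)"
    by (auto simp: seq_point_def)
  then show ?thesis by (simp add: rauzy_set_def)
qed

lemma rauzy_set_nonempty: "rauzy_set L R x \<noteq> {}"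
  by (simp add: rauzy_set_eq)

lemma seq_point_in_rauzy_set: "seq_point L R x n \<in> rauzy_set L R x"
  unfolding rauzy_set_eq by (intro subsetD[OF closure_subset]) simp

text \<open>
  If shifts of \<open>y\<close> converge to \<open>x\<close> while the corresponding points of the fractal of \<open>y\<close> converge
  to \<open>v\<close>, then every initial segment of the walk of \<open>x\<close> is, up to the translation by \<open>v\<close>, a limit
  of segments of the walk of \<open>y\<close>.
\<close>

lemma rauzy_set_add_limit:
  assumes agree: "\<And>k. seq_take k ((lshift ^^ n k) y) = seq_take k x"
    and r: "strict_mono r" and lim: "(\<lambda>k. seq_point L R y (n (r k))) \<longlonglongrightarrow> v"
    and z: "z \<in> rauzy_set L R x"
  shows "z + v \<in> rauzy_set L R y"
proof -
  have closed: "closed (rauzy_set L R y)" by (simp add: rauzy_set_eq)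
  have "seq_point L R x m + v \<in> rauzy_set L R y" for m
  proof -
    have "(\<lambda>k. seq_point L R y (n (r k)) + seq_point L R x m) \<longlonglongrightarrow> v + seq_point L R x m"
      by (intro tendsto_intros lim)
    moreover have "eventually (\<lambda>k. seq_point L R y (n (r k)) + seq_point L R x m =
        seq_point L R y (n (r k) + m)) sequentially"
      using eventually_ge_at_top[of m]
    proof eventually_elim
      case (elim k)
      then have "m \<le> r k" using seq_suble[OF r, of k] by simp
      then have "seq_point L R ((lshift ^^ n (r k)) y) m = seq_point L R x m"
        using agree[of "r k"] by (intro seq_point_cong[of "r k"])
      then show ?case by (simp add: seq_point_add)
    qed
    ultimately have "(\<lambda>k. seq_point L R y (n (r k) + m)) \<longlonglongrightarrow> v + seq_point L R x m"
      by (rule Lim_transform_eventually)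
    then show ?thesis
      using closed seq_point_in_rauzy_set unfolding add.commute[of v]
      by (rule closed_sequentially[rotated 2])
  qed
  then have "range (seq_point L R x) \<subseteq> (\<lambda>z. z + v) -` rauzy_set L R y" by auto
  moreover have "closed ((\<lambda>z. z + v) -` rauzy_set L R y)"
    using closed by (intro closed_vimage continuous_intros) auto
  ultimately have "rauzy_set L R x \<subseteq> (\<lambda>z. z + v) -` rauzy_set L R y"
    unfolding rauzy_set_eq[of L R x] by (rule closure_minimal)
  then show ?thesis using z by auto
qed

locale rauzy_reference =
  fixes \<theta> :: "'a::finite \<Rightarrow> 'a list pmf" and L R :: "real ^ 'a" and w :: "nat \<Rightarrow> 'a"
  assumes w_dense: "w \<in> subshift_dense \<theta>"
    and w_bounded: "bounded (range (seq_point L R w))"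
begin

abbreviation \<phi> :: "(nat \<Rightarrow> 'a) \<Rightarrow> real ^ 'a" where
  "\<phi> \<equiv> rauzy_shift L R w"

lemma bounded_rauzy_set: "bounded (rauzy_set L R w)"
  using w_bounded by (simp add: rauzy_set_eq bounded_closure)

lemma w_approximates:
  assumes "x \<in> subshift_dense \<theta>"
  shows "\<exists>n. seq_take m ((lshift ^^ n) w) = seq_take m x"
  using w_dense assms by (auto simp: subshift_dense_iff)

lemma rauzy_shift_eqI:
  assumes "v \<in> rauzy_set L R w" "rauzy_set L R x = (\<lambda>y. y - v) ` rauzy_set L R w"
  shows "\<phi> x = v"
  unfolding rauzy_shift_def
proof (rule the_equality)
  fix v'
  assume v': "v' \<in> rauzy_set L R w \<and> rauzy_set L R x = (\<lambda>y. y - v') ` rauzy_set L R w"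
  have "y + (v' - v) \<in> rauzy_set L R w" if "y \<in> rauzy_set L R w" for y
  proof -
    have "y - v \<in> (\<lambda>y. y - v') ` rauzy_set L R w" using that v' assms(2) by blast
    then obtain y' where "y' \<in> rauzy_set L R w" "y - v = y' - v'" by blast
    moreover from this(2) have "y + (v' - v) = y'" by (simp add: algebra_simps)
    ultimately show ?thesis by simp
  qed
  then have "v' - v = 0"
    by (intro bounded_translate_eq_0[OF bounded_rauzy_set rauzy_set_nonempty])
  then show "v' = v" by simp
qed (use assms in blast)

text \<open>
  Shifts of \<open>w\<close> converge to \<open>x\<close>, giving one inclusion between translates, and shifts of \<open>x\<close> converge
  to \<open>w\<close>, giving another one. Composing them, the bounded set \<open>\<R>(w)\<close> is mapped into itself by a
  translation, which must be trivial; so both inclusions are equalities.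
\<close>

lemma rauzy_shift_eq_limit:
  assumes x: "x \<in> subshift_dense \<theta>"
    and agree: "\<And>k. seq_take k ((lshift ^^ n k) w) = seq_take k x"
    and r: "strict_mono r" and lim: "(\<lambda>k. seq_point L R w (n (r k))) \<longlonglongrightarrow> v"
  shows "\<phi> x = v"
proof -
  have incl: "z + v \<in> rauzy_set L R w" if "z \<in> rauzy_set L R x" for z
    by (rule rauzy_set_add_limit[OF agree r lim that])
  have v: "v \<in> rauzy_set L R w"
    using incl[OF seq_point_in_rauzy_set[of L R x 0]] by simp
  have "rauzy_set L R x \<subseteq> (\<lambda>y. y - v) ` rauzy_set L R w"
  proof
    fix z assume "z \<in> rauzy_set L R x"
    then show "z \<in> (\<lambda>y. y - v) ` rauzy_set L R w"
      using incl by (intro image_eqI[of _ _ "z + v"]) auto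
  qed
  moreover have "bounded ((\<lambda>y. y - v) ` rauzy_set L R w)"
    using bounded_translation_minus[OF bounded_rauzy_set] by simp
  ultimately have bx: "bounded (rauzy_set L R x)" by (rule bounded_subset[rotated])
  have "\<forall>k. \<exists>m. seq_take k ((lshift ^^ m) x) = seq_take k w"
    using x w_dense by (auto simp: subshift_dense_iff)
  then obtain n' where agree': "\<And>k. seq_take k ((lshift ^^ n' k) x) = seq_take k w" by metis
  have "bounded (range (\<lambda>k. seq_point L R x (n' k)))"
    using bx by (rule bounded_subset) (auto simp: seq_point_in_rauzy_set)
  then obtain v' r' where r': "strict_mono r'" and lim': "((\<lambda>k. seq_point L R x (n' k)) \<circ> r') \<longlonglongrightarrow> v'"
    using bounded_imp_convergent_subsequence by blast
  have incl': "z + v' \<in> rauzy_set L R x" if "z \<in> rauzy_set L R w" for z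
    by (rule rauzy_set_add_limit[OF agree' r' _ that]) (use lim' in \<open>simp add: o_def\<close>)
  have "z + (v' + v) \<in> rauzy_set L R w" if "z \<in> rauzy_set L R w" for z
    using incl[OF incl'[OF that]] by (simp add: add.assoc)
  then have "v' + v = 0"
    by (intro bounded_translate_eq_0[OF bounded_rauzy_set rauzy_set_nonempty])
  then have "v' = - v" by (simp add: eq_neg_iff_add_eq_0)
  then have "(\<lambda>y. y - v) ` rauzy_set L R w \<subseteq> rauzy_set L R x"
    using incl' by auto
  then have "rauzy_set L R x = (\<lambda>y. y - v) ` rauzy_set L R w"
    using \<open>rauzy_set L R x \<subseteq> _\<close> by blast
  with v show "\<phi> x = v" by (rule rauzy_shift_eqI)
qed

lemma rauzy_shift_reference: "\<phi> w = 0"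
  using rauzy_shift_eq_limit[OF w_dense, of "\<lambda>_. 0" id 0] by (simp add: strict_mono_def)

text \<open>
  Otherwise there is a sequence of shifts of \<open>w\<close> converging to \<open>x\<close> whose points stay away from \<open>\<phi> x\<close>;
  but these points have a convergent subsequence, whose limit is \<open>\<phi> x\<close>.
\<close>

lemma seq_point_close_to_rauzy_shift:
  assumes x: "x \<in> subshift_dense \<theta>" and e: "0 < e"
  shows "\<exists>m. \<forall>n. seq_take m ((lshift ^^ n) w) = seq_take m x \<longrightarrow> dist (seq_point L R w n) (\<phi> x) < e"
proof (rule ccontr)
  assume "\<not> ?thesis"
  then obtain n where agree: "\<And>k. seq_take k ((lshift ^^ n k) w) = seq_take k x"
    and far: "\<And>k. e \<le> dist (seq_point L R w (n k)) (\<phi> x)"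
    by (metis not_less)
  have "bounded (range (\<lambda>k. seq_point L R w (n k)))"
    using w_bounded by (rule bounded_subset) auto
  then obtain v r where r: "strict_mono r" and lim: "((\<lambda>k. seq_point L R w (n k)) \<circ> r) \<longlonglongrightarrow> v"
    using bounded_imp_convergent_subsequence by blast
  then have "\<phi> x = v"
    using rauzy_shift_eq_limit[OF x agree r, of v] by (simp add: o_def)
  then obtain k where "dist (seq_point L R w (n (r k))) (\<phi> x) < e"
    using metric_LIMSEQ_D[OF lim e] by (auto simp: o_def)
  with far[of "r k"] show False by simp
qed

text \<open>
  If \<open>z\<close> is close to \<open>x\<close>, then a shift of \<open>w\<close> that is sufficiently close to \<open>z\<close> is close to both, and its
  point approximates both \<open>\<phi> z\<close> and \<open>\<phi> x\<close>.
\<close>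

lemma rauzy_shift_continuous:
  assumes x: "x \<in> subshift_dense \<theta>" and e: "0 < e"
  shows "\<exists>m. \<forall>z\<in>subshift_dense \<theta>. seq_take m z = seq_take m x \<longrightarrow> dist (\<phi> z) (\<phi> x) < e"
proof -
  obtain m where m: "\<And>n. seq_take m ((lshift ^^ n) w) = seq_take m x \<Longrightarrow>
      dist (seq_point L R w n) (\<phi> x) < e / 2"
    using seq_point_close_to_rauzy_shift[OF x, of "e / 2"] e by auto
  have "dist (\<phi> z) (\<phi> x) < e" if z: "z \<in> subshift_dense \<theta>" and zx: "seq_take m z = seq_take m x" for z
  proof -
    obtain m' where m': "\<And>n. seq_take m' ((lshift ^^ n) w) = seq_take m' z \<Longrightarrow>
        dist (seq_point L R w n) (\<phi> z) < e / 2"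
      using seq_point_close_to_rauzy_shift[OF z, of "e / 2"] e by auto
    obtain n where n: "seq_take (max m m') ((lshift ^^ n) w) = seq_take (max m m') z"
      using w_approximates[OF z] by blast
    have "seq_take m ((lshift ^^ n) w) = seq_take m z" "seq_take m' ((lshift ^^ n) w) = seq_take m' z"
      using n by (auto intro: seq_take_mono)
    then have "dist (seq_point L R w n) (\<phi> z) < e / 2" "dist (seq_point L R w n) (\<phi> x) < e / 2"
      using m m' zx by simp_all
    then show ?thesis by (rule dist_triangle_half_r)
  qed
  then show ?thesis by blast
qed

text \<open>
  If shifts of \<open>w\<close> converge to \<open>x\<close>, then the shifts one place further converge to \<open>lshift x\<close>, and the
  points of the walk of \<open>w\<close> differ by the step of the first letter of \<open>x\<close>.
\<close>

lemma rauzy_shift_lshift: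
  assumes x: "x \<in> subshift_dense \<theta>" and Sx: "lshift x \<in> subshift_dense \<theta>"
  shows "\<phi> (lshift x) = \<phi> x + rauzy_point L R [x 0]"
proof -
  have "dist (\<phi> (lshift x)) (\<phi> x + rauzy_point L R [x 0]) < e" if e: "0 < e" for e
  proof -
    obtain m where m: "\<And>n. seq_take m ((lshift ^^ n) w) = seq_take m x \<Longrightarrow>
        dist (seq_point L R w n) (\<phi> x) < e / 2"
      using seq_point_close_to_rauzy_shift[OF x, of "e / 2"] e by auto
    obtain m' where m': "\<And>n. seq_take m' ((lshift ^^ n) w) = seq_take m' (lshift x) \<Longrightarrow>
        dist (seq_point L R w n) (\<phi> (lshift x)) < e / 2"
      using seq_point_close_to_rauzy_shift[OF Sx, of "e / 2"] e by auto
    obtain n where n: "seq_take (max m (Suc m')) ((lshift ^^ n) w) = seq_take (max m (Suc m')) x"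
      using w_approximates[OF x] by blast
    have 1: "dist (seq_point L R w n) (\<phi> x) < e / 2"
      using n by (intro m) (auto intro: seq_take_mono)
    have "seq_take m' ((lshift ^^ (Suc n)) w) = seq_take m' (lshift x)"
      unfolding seq_take_eq_iff
    proof (intro allI impI)
      fix k assume "k < m'"
      then show "(lshift ^^ Suc n) w k = lshift x k"
        using n[unfolded seq_take_eq_iff, rule_format, of "Suc k"]
        by (simp add: funpow_lshift lshift_def)
    qed
    then have 2: "dist (seq_point L R w (Suc n)) (\<phi> (lshift x)) < e / 2"
      by (rule m')
    have "seq_take 1 ((lshift ^^ n) w) = [x 0]"
      using n by (auto simp: seq_take_eq_iff seq_take_def)
    then have "seq_point L R w (Suc n) = seq_point L R w n + rauzy_point L R [x 0]"
      using seq_point_add[of L R w n 1] by (simp add: seq_point_def)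
    then have "dist (seq_point L R w (Suc n)) (\<phi> x + rauzy_point L R [x 0]) < e / 2"
      using 1 by simp
    with 2 show ?thesis
      by (metis dist_commute dist_triangle_half_r)
  qed
  then show ?thesis
    by (metis dist_eq_0_iff less_irrefl zero_less_dist_iff)
qed

lemma rauzy_shift_funpow:
  assumes "\<And>i. (lshift ^^ i) x \<in> subshift_dense \<theta>"
  shows "\<phi> ((lshift ^^ i) x) = \<phi> x + seq_point L R x i"
proof (induction i)
  case (Suc i)
  have "seq_take 1 ((lshift ^^ i) x) = [(lshift ^^ i) x 0]"
    by (simp add: seq_take_def)
  then have "seq_point L R x (Suc i) = seq_point L R x i + rauzy_point L R [(lshift ^^ i) x 0]"
    using seq_point_add[of L R x i 1] by (simp add: seq_point_def)
  then show ?case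
    using rauzy_shift_lshift[OF assms[of i]] assms[of "Suc i"] Suc by (simp add: add.assoc)
qed simp

end

section \<open>The pointwise ergodic theorem for bounded functions\<close>

definition birkhoff_sum :: "('b \<Rightarrow> 'b) \<Rightarrow> ('b \<Rightarrow> real) \<Rightarrow> nat \<Rightarrow> 'b \<Rightarrow> real" where
  "birkhoff_sum T f n x = (\<Sum>i<n. f ((T ^^ i) x))"

lemma birkhoff_sum_0 [simp]: "birkhoff_sum T f 0 x = 0"
  by (simp add: birkhoff_sum_def)

lemma birkhoff_sum_Suc: "birkhoff_sum T f (Suc n) x = f x + birkhoff_sum T f n (T x)"
  by (simp add: birkhoff_sum_def sum.lessThan_Suc_shift funpow_swap1 del: sum.lessThan_Suc)

text \<open>This is the maximum of the Birkhoff sums of lengths \<open>0, \<dots>, n\<close>.\<close>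

primrec max_birkhoff_sum :: "('b \<Rightarrow> 'b) \<Rightarrow> ('b \<Rightarrow> real) \<Rightarrow> nat \<Rightarrow> 'b \<Rightarrow> real" where
  "max_birkhoff_sum T f 0 x = 0"
| "max_birkhoff_sum T f (Suc n) x = max 0 (f x + max_birkhoff_sum T f n (T x))"

lemma max_birkhoff_sum_nonneg: "0 \<le> max_birkhoff_sum T f n x"
  by (cases n) auto

lemma max_birkhoff_sum_mono: "m \<le> n \<Longrightarrow> max_birkhoff_sum T f m x \<le> max_birkhoff_sum T f n x"
proof (induction m arbitrary: n x)
  case (Suc m)
  then obtain k where k: "n = Suc k" "m \<le> k" by (cases n) auto
  show ?case using Suc.IH[OF k(2), of "T x"] by (auto simp: k(1))
qed (simp add: max_birkhoff_sum_nonneg)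

lemma birkhoff_sum_le_max: "birkhoff_sum T f n x \<le> max_birkhoff_sum T f n x"
  by (induction n arbitrary: x) (auto simp: birkhoff_sum_Suc intro: le_max_iff_disj[THEN iffD2])

lemma max_birkhoff_sum_le:
  assumes "\<And>x. \<bar>f x\<bar> \<le> B"
  shows "max_birkhoff_sum T f n x \<le> real n * B"
proof (induction n arbitrary: x)
  case (Suc n)
  have "0 \<le> B" using assms[of x] by linarith
  have "f x + max_birkhoff_sum T f n (T x) \<le> B + real n * B"
    using Suc[of "T x"] assms[of x] by linarith
  with \<open>0 \<le> B\<close> show ?case by (auto simp: algebra_simps)
qed simp

locale ergodic_system = prob_space M for M :: "'b measure" +
  fixes T :: "'b \<Rightarrow> 'b"
  assumes measurable_T [measurable]: "T \<in> measurable M M"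
    and distr_T: "distr M M T = M"
    and ergodic: "\<And>A. A \<in> sets M \<Longrightarrow> T -` A \<inter> space M = A \<Longrightarrow> measure M A = 0 \<or> measure M A = 1"
begin

lemma T_space: "x \<in> space M \<Longrightarrow> T x \<in> space M"
  using measurable_T by (rule measurable_space)

lemma measurable_birkhoff_sum [measurable]:
  assumes [measurable]: "f \<in> borel_measurable M"
  shows "birkhoff_sum T f n \<in> borel_measurable M"
  unfolding birkhoff_sum_def by measurable

lemma measurable_max_birkhoff_sum [measurable]:
  assumes [measurable]: "f \<in> borel_measurable M"
  shows "max_birkhoff_sum T f n \<in> borel_measurable M"
proof (induction n)
  case (Suc n)
  note [measurable] = Suc
  show ?case by (simp add: measurable_If[measurable])
qed simp

lemma integrable_max_birkhoff_sum:
  assumes "f \<in> borel_measurable M" "\<And>x. \<bar>f x\<bar> \<le> B"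
  shows "integrable M (max_birkhoff_sum T f n)"
  using assms max_birkhoff_sum_le[of f B T n] max_birkhoff_sum_nonneg[of T f n]
  by (intro integrable_const_bound[where B = "real n * B"]) auto

text \<open>
  Where the maximum \<open>F\<close> is positive it is attained by a sum of positive length, so that
  \<open>F \<le> f + F \<circ> T\<close> there, while \<open>F = 0 \<le> F \<circ> T\<close> elsewhere. Integrating, the two occurrences of
  \<open>F\<close> cancel by invariance.
\<close>

lemma maximal_ergodic_inequality:
  assumes f [measurable]: "f \<in> borel_measurable M" and B: "\<And>x. \<bar>f x\<bar> \<le> B"
  shows "0 \<le> (\<integral>x. indicator {x. 0 < max_birkhoff_sum T f n x} x * f x \<partial>M)"
proof (cases n)
  case (Suc m)
  let ?F = "max_birkhoff_sum T f n"
  have int: "integrable M ?F" by (rule integrable_max_birkhoff_sum[OF f B])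
  then have intT: "integrable M (\<lambda>x. ?F (T x))"
    by (subst integrable_distr_eq[where N = M and g = T, symmetric]) (auto simp: distr_T)
  have "(\<integral>x. ?F (T x) \<partial>M) = (\<integral>x. ?F x \<partial>distr M M T)"
    by (rule integral_distr[symmetric]) auto
  then have "0 = (\<integral>x. ?F x - ?F (T x) \<partial>M)"
    using int intT by (simp add: distr_T)
  also have "\<dots> \<le> (\<integral>x. indicator {x. 0 < ?F x} x * f x \<partial>M)"
  proof (rule integral_mono)
    have "(\<lambda>x. indicator {x. 0 < ?F x} x * f x) = (\<lambda>x. if 0 < ?F x then f x else 0)"
      by (auto simp: fun_eq_iff)
    moreover have "integrable M (\<lambda>x. if 0 < ?F x then f x else 0)"
      using B order_trans[OF abs_ge_zero B] by (intro integrable_const_bound[where B = B]) auto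
    ultimately show "integrable M (\<lambda>x. indicator {x. 0 < ?F x} x * f x)"
      by simp
    fix x
    show "?F x - ?F (T x) \<le> indicator {x. 0 < ?F x} x * f x"
    proof (cases "0 < ?F x")
      case True
      then have "?F x = f x + max_birkhoff_sum T f m (T x)"
        by (auto simp: Suc max_def split: if_splits)
      moreover have "max_birkhoff_sum T f m (T x) \<le> ?F (T x)"
        by (rule max_birkhoff_sum_mono) (simp add: Suc)
      ultimately show ?thesis using True by simp
    next
      case False
      then show ?thesis
        using max_birkhoff_sum_nonneg[of T f n "T x"] by simp
    qed
  qed (use int intT in auto)
  finally show ?thesis .
qed simp

text \<open>
  The set where the Birkhoff sums are unbounded above is invariant. On it the maximum of the first
  \<open>n\<close> sums is eventually positive, so if it had full measure, then the maximal inequality would give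
  \<open>0 \<le> \<integral>f\<close> in the limit.
\<close>

lemma AE_birkhoff_sums_bounded_above:
  assumes f [measurable]: "f \<in> borel_measurable M" and B: "\<And>x. \<bar>f x\<bar> \<le> B"
    and neg: "(\<integral>x. f x \<partial>M) < 0"
  shows "AE x in M. \<exists>K. \<forall>n. birkhoff_sum T f n x \<le> K"
proof -
  define E where "E = {x \<in> space M. \<forall>K::nat. \<exists>n. real K < birkhoff_sum T f n x}"
  have E [measurable]: "E \<in> sets M" unfolding E_def by measurable
  have "T x \<in> E \<longleftrightarrow> x \<in> E" if x: "x \<in> space M" for x
  proof
    assume Tx: "T x \<in> E"
    have "\<exists>n. real K < birkhoff_sum T f n x" for K
    proof -
      obtain n where "real (K + nat \<lceil>B\<rceil>) < birkhoff_sum T f n (T x)"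
        using Tx unfolding E_def by blast
      moreover have "B \<le> real (nat \<lceil>B\<rceil>)" by linarith
      ultimately have "real K < birkhoff_sum T f (Suc n) x"
        using B[of x] unfolding birkhoff_sum_Suc by linarith
      then show ?thesis by blast
    qed
    with x show "x \<in> E" by (simp add: E_def)
  next
    assume "x \<in> E"
    have "\<exists>n. real K < birkhoff_sum T f n (T x)" for K
    proof -
      obtain n where n: "real (K + nat \<lceil>B\<rceil>) < birkhoff_sum T f n x"
        using \<open>x \<in> E\<close> unfolding E_def by blast
      then obtain m where m: "n = Suc m" by (cases n) auto
      have "B \<le> real (nat \<lceil>B\<rceil>)" by linarith
      then have "real K < birkhoff_sum T f m (T x)"
        using n B[of x] unfolding m birkhoff_sum_Suc by linarith
      then show ?thesis by blast
    qed
    with x show "T x \<in> E" by (simp add: E_def T_space)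
  qed
  then have "T -` E \<inter> space M = E"
    by (auto simp: E_def)
  then have "measure M E = 0 \<or> measure M E = 1"
    by (intro ergodic E)
  moreover have "measure M E \<noteq> 1"
  proof
    assume "measure M E = 1"
    then have AE_E: "AE x in M. x \<in> E"
      by (simp add: prob_eq_1)
    let ?I = "\<lambda>n x. if 0 < max_birkhoff_sum T f n x then f x else 0"
    have "(\<lambda>n. \<integral>x. ?I n x \<partial>M) \<longlonglongrightarrow> (\<integral>x. f x \<partial>M)"
    proof (rule integral_dominated_convergence[where w = "\<lambda>_. B"])
      show "AE x in M. (\<lambda>n. ?I n x) \<longlonglongrightarrow> f x"
        using AE_E
      proof eventually_elim
        case (elim x)
        then obtain k where "real 0 < birkhoff_sum T f k x" unfolding E_def by blast
        then have "0 < max_birkhoff_sum T f n x" if "k \<le> n" for n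
          using birkhoff_sum_le_max[of T f k x] max_birkhoff_sum_mono[OF that, of T f x] by simp
        then have "eventually (\<lambda>n. ?I n x = f x) sequentially"
          by (auto simp: eventually_sequentially)
        then show ?case by (rule tendsto_eventually)
      qed
      show "AE x in M. norm (?I n x) \<le> B" for n
        using B order_trans[OF abs_ge_zero B] by auto
    qed auto
    moreover have "0 \<le> (\<integral>x. ?I n x \<partial>M)" for n
    proof -
      have "?I n = (\<lambda>x. indicator {x. 0 < max_birkhoff_sum T f n x} x * f x)"
        by (auto simp: fun_eq_iff)
      then show ?thesis using maximal_ergodic_inequality[OF f B] by simp
    qed
    ultimately have "0 \<le> (\<integral>x. f x \<partial>M)"
      by (intro LIMSEQ_le_const) auto
    with neg show False by simp
  qed
  ultimately have "AE x in M. x \<notin> E"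
    by (intro AE_not_in) (auto simp: null_sets_def emeasure_eq_measure)
  then show ?thesis
    using AE_space
  proof eventually_elim
    case (elim x)
    then show ?case by (auto simp: E_def not_less)
  qed
qed

lemma AE_birkhoff_average_less:
  assumes f [measurable]: "f \<in> borel_measurable M" and B: "\<And>x. \<bar>f x\<bar> \<le> B"
    and c: "(\<integral>x. f x \<partial>M) < c"
  shows "AE x in M. eventually (\<lambda>n. birkhoff_sum T f n x / real n < c) sequentially"
proof -
  define c' where "c' = ((\<integral>x. f x \<partial>M) + c) / 2"
  have c': "(\<integral>x. f x \<partial>M) < c'" "c' < c" using c by (auto simp: c'_def)
  have int: "integrable M f" using B by (intro integrable_const_bound[where B = B]) auto
  have "AE x in M. \<exists>K. \<forall>n. birkhoff_sum T (\<lambda>x. f x - c') n x \<le> K"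
  proof (rule AE_birkhoff_sums_bounded_above)
    show "\<bar>f x - c'\<bar> \<le> B + \<bar>c'\<bar>" for x using B[of x] by linarith
    show "(\<integral>x. f x - c' \<partial>M) < 0" using int c' by (simp add: prob_space)
  qed auto
  then show ?thesis
  proof eventually_elim
    case (elim x)
    then obtain K where K: "\<And>n. birkhoff_sum T (\<lambda>x. f x - c') n x \<le> K" by blast
    have "(\<lambda>n. c' + K / real n) \<longlonglongrightarrow> c' + 0"
      by (intro tendsto_intros lim_const_over_n)
    then have "eventually (\<lambda>n. c' + K / real n < c) sequentially"
      using c'(2) by (intro order_tendstoD) auto
    then show ?case
      using eventually_gt_at_top[of 0]
    proof eventually_elim
      case (elim n)
      have "birkhoff_sum T f n x \<le> real n * c' + K"
        using K[of n] by (simp add: birkhoff_sum_def sum_subtractf)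
      then have "birkhoff_sum T f n x / real n \<le> c' + K / real n"
        using elim by (simp add: field_simps)
      then show ?case using elim by linarith
    qed
  qed
qed

theorem birkhoff_ergodic_theorem:
  assumes f [measurable]: "f \<in> borel_measurable M" and B: "\<And>x. \<bar>f x\<bar> \<le> B"
  shows "AE x in M. (\<lambda>n. birkhoff_sum T f n x / real n) \<longlonglongrightarrow> (\<integral>x. f x \<partial>M)"
proof -
  let ?I = "\<integral>x. f x \<partial>M"
  have "AE x in M. eventually (\<lambda>n. birkhoff_sum T f n x / real n < ?I + 1 / Suc k) sequentially" for k
    by (rule AE_birkhoff_average_less[OF f B]) auto
  moreover have "AE x in M. eventually (\<lambda>n. birkhoff_sum T (\<lambda>x. - f x) n x / real n < - ?I + 1 / Suc k)
      sequentially" for k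
    by (rule AE_birkhoff_average_less) (use B in auto)
  ultimately have "AE x in M. \<forall>k.
      eventually (\<lambda>n. birkhoff_sum T f n x / real n < ?I + 1 / Suc k) sequentially \<and>
      eventually (\<lambda>n. birkhoff_sum T (\<lambda>x. - f x) n x / real n < - ?I + 1 / Suc k) sequentially"
    by (subst AE_all_countable) auto
  then show ?thesis
  proof eventually_elim
    case (elim x)
    show ?case
    proof (rule tendstoI)
      fix e :: real
      assume "0 < e"
      then obtain k where k: "1 / Suc k < e" using nat_approx_posE by blast
      have "birkhoff_sum T (\<lambda>x. - f x) n x = - birkhoff_sum T f n x" for n
        by (simp add: birkhoff_sum_def sum_negf)
      with elim have "eventually (\<lambda>n. birkhoff_sum T f n x / real n < ?I + 1 / Suc k) sequentially"
        "eventually (\<lambda>n. - (birkhoff_sum T f n x) / real n < - ?I + 1 / Suc k) sequentially"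
        by auto
      then show "eventually (\<lambda>n. dist (birkhoff_sum T f n x / real n) ?I < e) sequentially"
      proof eventually_elim
        case (elim n)
        then show ?case using k by (simp add: dist_real_def)
      qed
    qed
  qed
qed

end

section \<open>Legal words have positive frequency\<close>

lemma occurrences_finite: "finite {k. k + length u \<le> length v \<and> take (length u) (drop k v) = u}"
  by (rule finite_subset[of _ "{..length v}"]) auto

lemma occurrences_append:
  assumes "u \<noteq> []"
  shows "occurrences u s + occurrences u t \<le> occurrences u (s @ t)"
proof -
  define Occ where "Occ v = {k. k + length u \<le> length v \<and> take (length u) (drop k v) = u}" for v
  have fin: "finite (Occ v)" for v unfolding Occ_def by (rule occurrences_finite)
  have "Occ s \<union> (+) (length s) ` Occ t \<subseteq> Occ (s @ t)"
    by (auto simp: Occ_def)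
  moreover have "Occ s \<inter> (+) (length s) ` Occ t = {}"
    using assms by (auto simp: Occ_def)
  ultimately have "card (Occ s) + card ((+) (length s) ` Occ t) \<le> card (Occ (s @ t))"
    using fin by (metis card_Un_disjoint card_mono finite_imageI)
  then show ?thesis
    by (simp add: occurrences_def Occ_def card_image)
qed

lemma occurrences_le_length:
  assumes "u \<noteq> []"
  shows "occurrences u v \<le> length v"
proof -
  have "{k. k + length u \<le> length v \<and> take (length u) (drop k v) = u} \<subseteq> {..<length v}"
    using assms by (cases u) auto
  then have "occurrences u v \<le> card {..<length v}"
    unfolding occurrences_def by (rule card_mono[OF finite_lessThan])
  then show ?thesis by simp
qed

lemma occurrences_pos: "sublist u v \<Longrightarrow> 1 \<le> occurrences u v"
proof -
  assume "sublist u v"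
  then obtain s t where "v = s @ u @ t" by (auto simp: sublist_def)
  then have "length s \<in> {k. k + length u \<le> length v \<and> take (length u) (drop k v) = u}"
    by simp
  then show ?thesis
    unfolding occurrences_def using occurrences_finite[of u v]
    by (metis (no_types, lifting) One_nat_def Suc_leI card_gt_0_iff empty_iff)
qed

lemma subst_word_append:
  "subst_word \<theta> (u @ v) = bind_pmf (subst_word \<theta> u) (\<lambda>s. map_pmf ((@) s) (subst_word \<theta> v))"
proof (induction u)
  case Nil
  then show ?case by (simp add: bind_return_pmf pmf.map_ident[of "subst_word \<theta> v"] cong: map_pmf_cong)
next
  case (Cons a u)
  then show ?case
    by (simp add: map_pmf_def bind_assoc_pmf bind_return_pmf)
qed

lemma subst_pow_append:
  "subst_pow \<theta> n (u @ v) = bind_pmf (subst_pow \<theta> n u) (\<lambda>s. map_pmf ((@) s) (subst_pow \<theta> n v))"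
proof (induction n)
  case 0
  then show ?case by (simp add: bind_return_pmf)
next
  case (Suc n)
  have "subst_pow \<theta> (Suc n) (u @ v) =
    bind_pmf (subst_pow \<theta> n u) (\<lambda>s. bind_pmf (subst_pow \<theta> n v) (\<lambda>t.
      bind_pmf (subst_word \<theta> s) (\<lambda>s'. map_pmf ((@) s') (subst_word \<theta> t))))"
    by (simp add: Suc bind_assoc_pmf subst_word_append bind_map_pmf)
  also have "\<dots> = bind_pmf (subst_pow \<theta> n u) (\<lambda>s. bind_pmf (subst_word \<theta> s) (\<lambda>s'.
      bind_pmf (subst_pow \<theta> n v) (\<lambda>t. map_pmf ((@) s') (subst_word \<theta> t))))"
    by (subst bind_commute_pmf) simp
  also have "\<dots> = bind_pmf (subst_pow \<theta> (Suc n) u) (\<lambda>s'. map_pmf ((@) s') (subst_pow \<theta> (Suc n) v))"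
    by (simp add: bind_assoc_pmf map_bind_pmf)
  finally show ?case .
qed

lemma subst_pow_add: "subst_pow \<theta> (m + n) u = bind_pmf (subst_pow \<theta> m u) (subst_pow \<theta> n)"
proof (induction n)
  case 0
  have "subst_pow \<theta> 0 = return_pmf" by (rule ext) simp
  then show ?case by (simp add: bind_return_pmf')
next
  case (Suc n)
  have "subst_pow \<theta> (Suc n) = (\<lambda>z. bind_pmf (subst_pow \<theta> n z) (subst_word \<theta>))" by (rule ext) simp
  with Suc show ?case by (simp add: bind_assoc_pmf)
qed

lemma subst_word_length_bounds:
  assumes "\<And>a v. v \<in> set_pmf (\<theta> a) \<Longrightarrow> 1 \<le> length v \<and> length v \<le> B"
    and "v \<in> set_pmf (subst_word \<theta> u)"
  shows "length u \<le> length v \<and> length v \<le> B * length u"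
  using assms(2)
proof (induction u arbitrary: v)
  case (Cons a u)
  then obtain s t where v: "v = s @ t" "s \<in> set_pmf (\<theta> a)" "t \<in> set_pmf (subst_word \<theta> u)"
    by auto
  show ?case using Cons.IH[OF v(3)] assms(1)[OF v(2)] by (simp add: v(1))
qed simp

lemma subst_pow_length_bounds:
  assumes "\<And>a v. v \<in> set_pmf (\<theta> a) \<Longrightarrow> 1 \<le> length v \<and> length v \<le> B"
    and "v \<in> set_pmf (subst_pow \<theta> n u)"
  shows "length u \<le> length v \<and> length v \<le> B ^ n * length u"
  using assms(2)
proof (induction n arbitrary: v)
  case (Suc n)
  then obtain t where t: "t \<in> set_pmf (subst_pow \<theta> n u)" "v \<in> set_pmf (subst_word \<theta> t)"
    by auto
  have "length v \<le> B * length t" "length t \<le> length v"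
    using subst_word_length_bounds[of \<theta> B, OF assms(1) t(2)] by auto
  moreover have "B * length t \<le> B * (B ^ n * length u)" "length u \<le> length t"
    using Suc.IH[OF t(1)] by (auto intro: mult_le_mono2)
  ultimately have "length u \<le> length v" "length v \<le> B * (B ^ n * length u)"
    by linarith+
  then show ?case by (simp add: mult.assoc)
qed simp

lemma random_substitution_length_bound:
  assumes "random_substitution \<theta>"
  obtains B where "\<And>a v. v \<in> set_pmf (\<theta> a) \<Longrightarrow> 1 \<le> length v \<and> length v \<le> B" "1 \<le> B"
proof
  let ?S = "\<Union>a. length ` set_pmf (\<theta> a)"
  have fin: "finite ?S" using assms by (auto simp: random_substitution_def)
  show "1 \<le> length v \<and> length v \<le> Suc (Max ?S)" if "v \<in> set_pmf (\<theta> a)" for a v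
  proof -
    have "length v \<le> Max ?S" using that fin by (intro Max_ge) auto
    moreover have "v \<noteq> []" using assms that by (auto simp: random_substitution_def)
    ultimately show ?thesis by (simp add: Suc_le_eq)
  qed
qed simp

text \<open>
  By compatibility, the number of letters \<open>b\<close> in every realisation of level \<open>n\<close> of \<open>a\<close> is the entry
  \<open>(b, a)\<close> of \<open>M\<^sup>n\<close>.
\<close>

lemma primitive_letter_occurs:
  fixes \<theta> :: "'a::finite \<Rightarrow> 'a list pmf"
  assumes "compatible \<theta>" "primitive_substitution \<theta>"
  obtains n where "\<And>a b v. v \<in> set_pmf (subst_pow \<theta> n [a]) \<Longrightarrow> b \<in> set v"
proof -
  let ?M = "subst_matrix \<theta> :: int ^ 'a ^ 'a"
  have eq: "subst_matrix \<theta> = map_matrix real_of_int ?M"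
    by (simp add: subst_matrix_def vec_eq_iff)
  obtain n where n: "\<And>i j. 0 < (((**) ?M ^^ n) (mat 1)) $ i $ j"
    using assms(2) by (auto simp: primitive_substitution_def primitive_matrix_def)
  have "b \<in> set v" if "v \<in> set_pmf (subst_pow \<theta> n [a])" for a b v
  proof -
    have "parikh v = map_matrix real_of_int (((**) ?M ^^ n) (mat 1)) *v axis a 1"
      using parikh_subst_pow[OF assms(1) that] unfolding funpow_matrix_of_int eq
      by (simp add: parikh_Cons)
    then have "parikh v $ b = (((**) ?M ^^ n) (mat 1)) $ b $ a"
      by (simp add: matrix_vector_mult_basis column_def)
    also have "\<dots> > 0" using n by simp
    finally have "count_list v b \<noteq> 0" by (simp add: parikh_def)
    then show ?thesis by (metis count_notin)
  qed
  then show thesis by (rule that)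
qed

lemma expected_occurrences_ge:
  assumes "u \<noteq> []" "\<And>j. ennreal p \<le> (\<integral>\<^sup>+v. of_nat (occurrences u v) \<partial>subst_pow \<theta> k [j])"
  shows "ennreal p * of_nat (length z) \<le> (\<integral>\<^sup>+v. of_nat (occurrences u v) \<partial>subst_pow \<theta> k z)"
proof (induction z)
  case (Cons a z)
  let ?N = "\<lambda>z. \<integral>\<^sup>+v. of_nat (occurrences u v) \<partial>subst_pow \<theta> k z"
  have "ennreal p * of_nat (length (a # z)) = ennreal p + ennreal p * of_nat (length z)"
    by (simp add: distrib_left)
  also have "\<dots> \<le> ?N [a] + ?N z"
    using assms(2) Cons by (rule add_mono)
  also have "\<dots> = (\<integral>\<^sup>+s. \<integral>\<^sup>+t. of_nat (occurrences u s) + of_nat (occurrences u t)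
      \<partial>subst_pow \<theta> k z \<partial>subst_pow \<theta> k [a])"
    by (simp add: nn_integral_add)
  also have "\<dots> \<le> (\<integral>\<^sup>+s. \<integral>\<^sup>+t. of_nat (occurrences u (s @ t)) \<partial>subst_pow \<theta> k z \<partial>subst_pow \<theta> k [a])"
    using occurrences_append[OF assms(1)]
    by (intro nn_integral_mono) (simp flip: of_nat_add)
  also have "\<dots> = ?N (a # z)"
    using subst_pow_append[of \<theta> k "[a]" z] by simp
  finally show ?case .
qed simp

text \<open>
  By primitivity some fixed power of the substitution produces the word \<open>u\<close> from every letter with
  positive probability. By linearity of expectation, the expected number of occurrences of \<open>u\<close>
  after this many further steps is at least proportional to the length of the current word.
\<close>

lemma expected_frequency_ge:
  assumes "random_substitution \<theta>" "compatible \<theta>" "primitive_substitution \<theta>"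
    and "y \<in> set_pmf (subst_pow \<theta> l [b])" "sublist u y" "u \<noteq> []"
  shows "\<exists>c>0. \<exists>k. \<forall>n\<ge>k. \<forall>a. ennreal c \<le>
           (\<integral>\<^sup>+v. ennreal (real (occurrences u v) / real (length v)) \<partial>subst_pow \<theta> n [a])"
proof -
  obtain B where B: "\<And>a v. v \<in> set_pmf (\<theta> a) \<Longrightarrow> 1 \<le> length v \<and> length v \<le> B" "1 \<le> B"
    using random_substitution_length_bound[OF assms(1)] by blast
  obtain n0 where n0: "\<And>a b v. v \<in> set_pmf (subst_pow \<theta> n0 [a]) \<Longrightarrow> b \<in> set v"
    using primitive_letter_occurs[OF assms(2,3)] by blast
  define k where "k = n0 + l"
  have "\<exists>v\<in>set_pmf (subst_pow \<theta> k [j]). sublist u v" for j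
  proof -
    obtain x where x: "x \<in> set_pmf (subst_pow \<theta> n0 [j])" by (meson all_not_in_conv set_pmf_not_empty)
    from n0[OF this, of b] obtain s t where st: "x = s @ [b] @ t"
      by (metis append_Cons append_Nil in_set_conv_decomp)
    obtain s' where s': "s' \<in> set_pmf (subst_pow \<theta> l s)" by (meson all_not_in_conv set_pmf_not_empty)
    obtain t' where t': "t' \<in> set_pmf (subst_pow \<theta> l t)" by (meson all_not_in_conv set_pmf_not_empty)
    have "y @ t' \<in> set_pmf (subst_pow \<theta> l ([b] @ t))"
      using assms(4) t' unfolding subst_pow_append by auto
    then have "s' @ y @ t' \<in> set_pmf (subst_pow \<theta> l x)"
      using s' unfolding st subst_pow_append[of _ _ s] by auto
    then have "s' @ y @ t' \<in> set_pmf (subst_pow \<theta> k [j])"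
      using x by (auto simp: k_def subst_pow_add)
    moreover have "sublist u (s' @ y @ t')"
      using assms(5) by (auto simp: sublist_append)
    ultimately show ?thesis by blast
  qed
  then obtain v where v: "\<And>j. v j \<in> set_pmf (subst_pow \<theta> k [j])" "\<And>j. sublist u (v j)"
    by metis
  define p where "p = Min (range (\<lambda>j. pmf (subst_pow \<theta> k [j]) (v j)))"
  have p: "0 < p" unfolding p_def using v(1) by (subst Min_gr_iff) (auto simp: pmf_positive)
  have pj: "ennreal p \<le> (\<integral>\<^sup>+v. of_nat (occurrences u v) \<partial>subst_pow \<theta> k [j])" for j
  proof -
    have "p \<le> pmf (subst_pow \<theta> k [j]) (v j)" unfolding p_def by (rule Min_le) auto
    then have "ennreal p \<le> emeasure (subst_pow \<theta> k [j]) {v j}"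
      by (simp add: emeasure_pmf_single ennreal_leI)
    also have "\<dots> = (\<integral>\<^sup>+x. indicator {v j} x \<partial>subst_pow \<theta> k [j])" by simp
    also have "\<dots> \<le> (\<integral>\<^sup>+v. of_nat (occurrences u v) \<partial>subst_pow \<theta> k [j])"
    proof (rule nn_integral_mono)
      have "(of_nat 1 :: ennreal) \<le> of_nat (occurrences u (v j))"
        by (rule of_nat_mono) (rule occurrences_pos[OF v(2)])
      then show "indicator {v j} x \<le> (of_nat (occurrences u x) :: ennreal)" for x
        by (cases "x = v j") simp_all
    qed
    finally show ?thesis .
  qed
  define D where "D = real B ^ k"
  have D: "0 < D" using B(2) by (simp add: D_def)
  have "ennreal (p / D) \<le>
      (\<integral>\<^sup>+v. ennreal (real (occurrences u v) / real (length v)) \<partial>subst_pow \<theta> (m + k) [a])" for m a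
  proof -
    have "ennreal (p / D) \<le> (\<integral>\<^sup>+v. ennreal (real (occurrences u v) / real (length v)) \<partial>subst_pow \<theta> k z)"
      if z: "z \<in> set_pmf (subst_pow \<theta> m [a])" for z
    proof -
      have lz: "1 \<le> length z" using subst_pow_length_bounds[of \<theta> B, OF B(1) z] by simp
      then have "z \<noteq> []" by auto
      define x where "x = 1 / (D * real (length z))"
      have x: "0 \<le> x" using D by (simp add: x_def)
      have "ennreal (p / D) = ennreal (x * (p * real (length z)))"
        using \<open>z \<noteq> []\<close> D by (simp add: x_def)
      also have "\<dots> = ennreal x * (ennreal p * of_nat (length z))"
        using x p by (simp add: ennreal_mult ennreal_of_nat_eq_real_of_nat)
      also have "\<dots> \<le> ennreal x * (\<integral>\<^sup>+v. of_nat (occurrences u v) \<partial>subst_pow \<theta> k z)"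
        using expected_occurrences_ge[OF assms(6) pj] p by (intro mult_left_mono) auto
      also have "\<dots> = (\<integral>\<^sup>+v. ennreal x * of_nat (occurrences u v) \<partial>subst_pow \<theta> k z)"
        by (rule nn_integral_cmult[symmetric]) simp
      also have "\<dots> \<le> (\<integral>\<^sup>+v. ennreal (real (occurrences u v) / real (length v)) \<partial>subst_pow \<theta> k z)"
      proof (rule nn_integral_mono_AE, rule AE_pmfI)
        fix v assume v: "v \<in> set_pmf (subst_pow \<theta> k z)"
        have lv: "length z \<le> length v" "length v \<le> B ^ k * length z"
          using subst_pow_length_bounds[of \<theta> B, OF B(1) v] by simp_all
        have "real (length v) \<le> D * length z"
          using lv(2) unfolding D_def by (simp flip: of_nat_power of_nat_mult)
        moreover have "0 < length v" using lz lv(1) by linarith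
        ultimately have "x * real (occurrences u v) \<le> real (occurrences u v) / real (length v)"
          by (simp add: x_def frac_le)
        then have "ennreal (x * real (occurrences u v)) \<le>
            ennreal (real (occurrences u v) / real (length v))"
          by (rule ennreal_leI)
        then show "ennreal x * of_nat (occurrences u v) \<le>
            ennreal (real (occurrences u v) / real (length v))"
          using x by (simp add: ennreal_mult ennreal_of_nat_eq_real_of_nat)
      qed
      finally show ?thesis .
    qed
    then have "(\<integral>\<^sup>+z. ennreal (p / D) \<partial>subst_pow \<theta> m [a]) \<le>
      (\<integral>\<^sup>+z. \<integral>\<^sup>+v. ennreal (real (occurrences u v) / real (length v)) \<partial>subst_pow \<theta> k z \<partial>subst_pow \<theta> m [a])"
      by (intro nn_integral_mono_AE AE_pmfI)
    then show ?thesis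
      by (simp add: subst_pow_add measure_pmf.emeasure_space_1)
  qed
  then show ?thesis
    using p D by (intro exI[of _ "p / D"] conjI exI[of _ k] allI impI)
      (simp, metis add.commute le_Suc_ex)
qed

text \<open>
  The initial segment of length \<open>n + 1\<close> of the Markov chain takes only countably many values, so its
  law is determined by the probabilities of single paths. This identifies the law of the chain at
  time \<open>n\<close>.
\<close>

primrec subst_path :: "('a \<Rightarrow> 'a list pmf) \<Rightarrow> 'a list \<Rightarrow> nat \<Rightarrow> 'a list list pmf" where
  "subst_path \<theta> u 0 = return_pmf [u]"
| "subst_path \<theta> u (Suc n) =
     bind_pmf (subst_path \<theta> u n) (\<lambda>p. map_pmf (\<lambda>v. p @ [v]) (subst_word \<theta> (last p)))"

lemma map_last_subst_path: "map_pmf last (subst_path \<theta> u n) = subst_pow \<theta> n u"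
proof (induction n)
  case (Suc n)
  have "map_pmf last (subst_path \<theta> u (Suc n)) =
    bind_pmf (subst_path \<theta> u n) (\<lambda>p. subst_word \<theta> (last p))"
    by (simp add: map_bind_pmf pmf.map_comp o_def)
  also have "\<dots> = bind_pmf (map_pmf last (subst_path \<theta> u n)) (subst_word \<theta>)"
    by (simp add: bind_map_pmf)
  finally show ?case by (simp add: Suc)
qed simp

lemma pmf_subst_path:
  "pmf (subst_path \<theta> u n) p =
     (if length p = Suc n \<and> p ! 0 = u then \<Prod>k<n. pmf (subst_word \<theta> (p ! k)) (p ! Suc k) else 0)"
proof (induction n arbitrary: p)
  case 0
  then show ?case by (cases p) (auto simp: pmf_return indicator_def)
next
  case (Suc n)
  show ?case
  proof (cases p rule: rev_cases)
    case Nil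
    have "pmf (map_pmf (\<lambda>v. q @ [v]) X) [] = 0" for q and X :: "'a list pmf"
      by (auto simp: pmf_eq_0_set_pmf)
    then show ?thesis using Nil by (simp add: pmf_bind)
  next
    case (snoc q v)
    have "pmf (map_pmf (\<lambda>v. q' @ [v]) (subst_word \<theta> (last q'))) p =
      (if q' = q then pmf (subst_word \<theta> (last q)) v else 0)" for q'
    proof (cases "q' = q")
      case True
      then show ?thesis
        using pmf_map_inj'[of "\<lambda>v. q @ [v]" "subst_word \<theta> (last q)" v] by (simp add: snoc inj_def)
    next
      case False
      then show ?thesis by (auto simp: pmf_eq_0_set_pmf snoc)
    qed
    then have "pmf (subst_path \<theta> u (Suc n)) p =
      pmf (subst_path \<theta> u n) q * pmf (subst_word \<theta> (last q)) v"
      by (simp add: pmf_bind integral_measure_pmf_real[of "{q}"] split: if_splits)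
    also have "\<dots> = (if length p = Suc (Suc n) \<and> p ! 0 = u
        then \<Prod>k<Suc n. pmf (subst_word \<theta> (p ! k)) (p ! Suc k) else 0)"
    proof (cases "length q = Suc n")
      case True
      then have "last q = q ! n" by (metis diff_Suc_1 last_conv_nth length_0_conv nat.distinct(1))
      moreover have "(\<Prod>k<n. pmf (subst_word \<theta> (p ! k)) (p ! Suc k)) =
        (\<Prod>k<n. pmf (subst_word \<theta> (q ! k)) (q ! Suc k))"
        using True by (intro prod.cong) (auto simp: snoc nth_append)
      ultimately show ?thesis
        using True Suc[of q] by (simp add: snoc nth_append)
    next
      case False
      then show ?thesis using Suc[of q] by (simp add: snoc)
    qed
    finally show ?thesis .
  qed
qed

lemma distr_subst_chain_law:
  fixes \<theta> :: "'a::finite \<Rightarrow> 'a list pmf"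
  assumes "subst_chain_law \<theta> u Q"
  shows "distr Q (count_space UNIV) (\<lambda>\<omega>. \<omega> n) = measure_pmf (subst_pow \<theta> n u)"
proof -
  interpret Q: prob_space Q using assms by (simp add: subst_chain_law_def)
  have sets_Q [measurable_cong]: "sets Q = sets (PiM UNIV (\<lambda>_. count_space UNIV))"
    using assms by (simp add: subst_chain_law_def)
  have space_Q: "space Q = UNIV"
    using sets_eq_imp_space_eq[OF sets_Q] by (simp add: space_PiM)
  let ?f = "\<lambda>\<omega> :: nat \<Rightarrow> 'a list. map \<omega> [0..<Suc n]"
  have pre: "?f -` {p} = (if length p = Suc n then {\<omega>. \<forall>k\<le>n. \<omega> k = p ! k} else {})" for p
  proof (cases "length p = Suc n")
    case True
    then have "map \<omega> [0..<Suc n] = p \<longleftrightarrow> (\<forall>k<Suc n. \<omega> k = p ! k)" for \<omega>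
      unfolding list_eq_iff_nth_eq by (simp del: upt_Suc)
    with True show ?thesis by (auto simp: less_Suc_eq_le simp del: upt_Suc)
  next
    case False
    then have "map \<omega> [0..<Suc n] \<noteq> p" for \<omega> by (metis diff_zero length_map length_upt)
    with False show ?thesis by (auto simp del: upt_Suc)
  qed
  have cyl: "{\<omega>. \<forall>k\<le>n. \<omega> k = v k} \<in> sets Q" for v
  proof -
    have "{\<omega> \<in> space Q. \<forall>k\<le>n. \<omega> k = v k} \<in> sets Q" by measurable
    then show ?thesis by (simp add: space_Q)
  qed
  have meas: "?f \<in> measurable Q (count_space UNIV)"
    unfolding measurable_count_space_eq2_countable using pre cyl by (auto simp: space_Q)
  have "distr Q (count_space UNIV) ?f = measure_pmf (subst_path \<theta> u n)"
  proof (rule measure_eqI_countable[of _ UNIV])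
    fix p
    have "emeasure (distr Q (count_space UNIV) ?f) {p} = emeasure Q (?f -` {p})"
      using meas by (subst emeasure_distr) (auto simp: space_Q)
    also have "\<dots> = ennreal (pmf (subst_path \<theta> u n) p)"
    proof (cases "length p = Suc n")
      case True
      have "measure Q {\<omega>. \<forall>k\<le>n. \<omega> k = p ! k} =
        (if p ! 0 = u then \<Prod>k<n. pmf (subst_word \<theta> (p ! k)) (p ! Suc k) else 0)"
        using assms unfolding subst_chain_law_def by blast
      then show ?thesis
        using True unfolding pre by (simp add: Q.emeasure_eq_measure pmf_subst_path)
    next
      case False
      then show ?thesis unfolding pre by (simp add: pmf_subst_path)
    qed
    finally show "emeasure (distr Q (count_space UNIV) ?f) {p} = emeasure (measure_pmf (subst_path \<theta> u n)) {p}"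
      by (simp add: emeasure_pmf_single)
  qed auto
  then have "distr (distr Q (count_space UNIV) ?f) (count_space UNIV) last =
    measure_pmf (map_pmf last (subst_path \<theta> u n))"
    by (simp add: map_pmf_rep_eq)
  also have "distr (distr Q (count_space UNIV) ?f) (count_space UNIV) last =
    distr Q (count_space UNIV) (\<lambda>\<omega>. \<omega> n)"
    using meas by (subst distr_distr) (auto simp: o_def)
  finally show ?thesis by (simp add: map_last_subst_path)
qed

text \<open>
  The relative frequencies of \<open>u\<close> converge almost surely and are at most \<open>1\<close>, so their expectations
  converge to \<open>\<rho>([u])\<close> as well, and these are bounded away from \<open>0\<close>.
\<close>

lemma frequency_pos:
  assumes "random_substitution \<theta>" "compatible \<theta>" "primitive_substitution \<theta>"
    and "frequency_measure \<theta> \<rho>"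
    and "y \<in> set_pmf (subst_pow \<theta> l [b])" "sublist u y" "u \<noteq> []"
  shows "0 < measure \<rho> (cylinder u)"
proof -
  obtain c k where c: "0 < c" and k: "\<And>n. k \<le> n \<Longrightarrow> ennreal c \<le>
      (\<integral>\<^sup>+v. ennreal (real (occurrences u v) / real (length v)) \<partial>subst_pow \<theta> n [b])"
    using expected_frequency_ge[OF assms(1-3,5-7)] by blast
  obtain Q where Q: "subst_chain_law \<theta> [b] Q"
    and freq: "AE \<omega> in Q. \<forall>u. (\<lambda>n. real (occurrences u (\<omega> n)) / real (length (\<omega> n)))
                          \<longlonglongrightarrow> measure \<rho> (cylinder u)"
    using assms(4) unfolding frequency_measure_def by blast
  interpret Q: prob_space Q using Q by (simp add: subst_chain_law_def)
  have sets_Q [measurable_cong]: "sets Q = sets (PiM UNIV (\<lambda>_. count_space UNIV))"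
    using Q by (simp add: subst_chain_law_def)
  define g where "g v = real (occurrences u v) / real (length v)" for v
  have g: "0 \<le> g v" "g v \<le> 1" for v
    using occurrences_le_length[OF assms(7), of v] by (auto simp: g_def divide_le_eq)
  have comp [measurable]: "(\<lambda>\<omega>. \<omega> n) \<in> measurable Q (count_space UNIV)" for n
    by measurable
  have "(\<lambda>n. \<integral>\<omega>. g (\<omega> n) \<partial>Q) \<longlonglongrightarrow> (\<integral>\<omega>. measure \<rho> (cylinder u) \<partial>Q)"
  proof (rule integral_dominated_convergence[where w = "\<lambda>_. 1"])
    show "AE \<omega> in Q. (\<lambda>n. g (\<omega> n)) \<longlonglongrightarrow> measure \<rho> (cylinder u)"
      using freq by eventually_elim (simp add: g_def)
    show "AE \<omega> in Q. norm (g (\<omega> n)) \<le> 1" for n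
      using g by simp
  qed (auto intro: measurable_compose[OF comp])
  then have lim: "(\<lambda>n. \<integral>\<omega>. g (\<omega> n) \<partial>Q) \<longlonglongrightarrow> measure \<rho> (cylinder u)"
    by (simp add: Q.prob_space)
  have "c \<le> (\<integral>\<omega>. g (\<omega> n) \<partial>Q)" if "k \<le> n" for n
  proof -
    have "(\<integral>\<omega>. g (\<omega> n) \<partial>Q) = (\<integral>v. g v \<partial>measure_pmf (subst_pow \<theta> n [b]))"
      by (subst distr_subst_chain_law[OF Q, symmetric], subst integral_distr) auto
    moreover have "ennreal c \<le> ennreal (\<integral>v. g v \<partial>measure_pmf (subst_pow \<theta> n [b]))"
    proof -
      have "integrable (measure_pmf (subst_pow \<theta> n [b])) g"
        using g by (intro measure_pmf.integrable_const_bound[where B = 1]) auto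
      then show ?thesis
        using k[OF that] g by (subst nn_integral_eq_integral[symmetric]) (auto simp: g_def)
    qed
    ultimately show ?thesis
      using g by (simp add: ennreal_le_iff integral_nonneg_AE)
  qed
  then have "c \<le> measure \<rho> (cylinder u)"
    by (intro LIMSEQ_le_const[OF lim]) auto
  with c show ?thesis by simp
qed

section \<open>Finite sums of measures\<close>

lemma sets_sum_measure [simp, measurable_cong]: "sets (sum_measure N I M) = sets N"
  by (simp add: sum_measure_def sets_measure_of_conv sets.sigma_sets_eq sets.space_closed)

lemma space_sum_measure [simp]: "space (sum_measure N I M) = space N"
  by (simp add: sum_measure_def space_measure_of_conv)

lemma emeasure_sum_measure:
  fixes N :: "'b measure"
  assumes "finite I" "\<And>i. i \<in> I \<Longrightarrow> sets (M i) = sets N" "B \<in> sets N"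
  shows "emeasure (sum_measure N I M) B = (\<Sum>i\<in>I. emeasure (M i) B)"
  unfolding sum_measure_def
proof (rule emeasure_measure_of_sigma)
  show "sigma_algebra (space N) (sets N)" by (rule sets.sigma_algebra_axioms)
  show "positive (sets N) (\<lambda>B. \<Sum>i\<in>I. emeasure (M i) B)" by (simp add: positive_def)
  show "countably_additive (sets N) (\<lambda>B. \<Sum>i\<in>I. emeasure (M i) B)"
  proof (rule countably_additiveI)
    fix A :: "nat \<Rightarrow> 'b set"
    assume A: "range A \<subseteq> sets N" "disjoint_family A"
    have "(\<Sum>n. \<Sum>i\<in>I. emeasure (M i) (A n)) = (\<Sum>i\<in>I. \<Sum>n. emeasure (M i) (A n))"
      by (rule suminf_sum) auto
    also have "\<dots> = (\<Sum>i\<in>I. emeasure (M i) (\<Union>n. A n))"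
      using A assms(2) by (intro sum.cong refl suminf_emeasure) auto
    finally show "(\<Sum>n. \<Sum>i\<in>I. emeasure (M i) (A n)) = (\<Sum>i\<in>I. emeasure (M i) (\<Union>n. A n))" .
  qed
qed (use assms in auto)

lemma integral_scaled_sum_of_points:
  assumes I: "finite I" and p: "\<And>i. i \<in> I \<Longrightarrow> p i \<in> space N" and f: "f \<in> borel_measurable N"
    and c: "0 \<le> c"
  shows "(\<integral>x. f x \<partial>scale_measure (ennreal c) (sum_measure N I (\<lambda>i. return N (p i)))) =
           c * (\<Sum>i\<in>I. f (p i) :: real)"
proof -
  have pm: "p \<in> measurable (count_space I) N" using p by simp
  have eq: "sum_measure N I (\<lambda>i. return N (p i)) = distr (count_space I) N p"
  proof (rule measure_eqI)
    fix B assume "B \<in> sets (sum_measure N I (\<lambda>i. return N (p i)))"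
    then have B: "B \<in> sets N" by simp
    have "emeasure (sum_measure N I (\<lambda>i. return N (p i))) B = (\<Sum>i\<in>I. indicator B (p i))"
      using I B by (subst emeasure_sum_measure) auto
    also have "\<dots> = of_nat (card {i\<in>I. p i \<in> B})"
      using I by (simp add: indicator_def sum.If_cases Int_def)
    also have "\<dots> = emeasure (distr (count_space I) N p) B"
      using I B pm by (subst emeasure_distr) (auto simp: emeasure_count_space vimage_def Int_def conj_commute)
    finally show "emeasure (sum_measure N I (\<lambda>i. return N (p i))) B = emeasure (distr (count_space I) N p) B" .
  qed simp
  let ?D = "distr (count_space I) N p"
  have "scale_measure (ennreal c) ?D = density ?D (\<lambda>_. ennreal c)"
    by (rule measure_eqI) (auto simp: emeasure_density nn_integral_cmult_indicator)
  then have "(\<integral>x. f x \<partial>scale_measure (ennreal c) ?D) = c * (\<integral>x. f x \<partial>?D)"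
    using f c by (simp add: integral_density)
  also have "(\<integral>x. f x \<partial>?D) = (\<Sum>i\<in>I. f (p i))"
    using I f pm by (simp add: integral_distr lebesgue_integral_count_space_finite)
  finally show ?thesis by (simp add: eq)
qed

text \<open>
  A finite Borel measure is determined by its values on closed sets, and the indicator of a closed
  set \<open>C\<close> is the decreasing limit of the continuous functions \<open>max 0 (1 - k d(x, C))\<close>.
\<close>

lemma sum_measure_eqI_continuous:
  fixes M :: "'i \<Rightarrow> 'b::metric_space measure"
  assumes I: "finite I" and M: "\<And>i. i \<in> I \<Longrightarrow> finite_measure (M i)" "\<And>i. i \<in> I \<Longrightarrow> sets (M i) = sets borel"
    and N: "finite_measure N" "sets N = sets borel"
    and eq: "\<And>f :: 'b \<Rightarrow> real. continuous_on UNIV f \<Longrightarrow> bounded (range f) \<Longrightarrow>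
      (\<Sum>i\<in>I. \<integral>x. f x \<partial>M i) = (\<integral>x. f x \<partial>N)"
  shows "sum_measure borel I M = N"
proof -
  have closed: "(\<Sum>i\<in>I. measure (M i) C) = measure N C" if "closed C" for C
  proof (cases "C = {}")
    case False
    define f where "f k x = max 0 (1 - real k * infdist x C)" for k x
    have f_cont: "continuous_on UNIV (f k)" for k
      unfolding f_def by (intro continuous_intros)
    have f_bound: "norm (f k x) \<le> 1" for k x
      by (simp add: f_def infdist_nonneg)
    have f_lim: "(\<lambda>k. f k x) \<longlonglongrightarrow> indicator C x" for x
    proof (cases "x \<in> C")
      case False
      then have d: "0 < infdist x C"
        using that \<open>C \<noteq> {}\<close> infdist_pos_not_in_closed by blast
      obtain K where K: "1 / infdist x C < real K" using reals_Archimedean2 by blast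
      have "f k x = 0" if "K \<le> k" for k
      proof -
        have "1 / infdist x C < real k" using K that by linarith
        then have "1 < real k * infdist x C" using d by (simp add: field_simps)
        then show ?thesis by (simp add: f_def)
      qed
      then have "eventually (\<lambda>k. f k x = indicator C x) sequentially"
        using False by (auto simp: eventually_sequentially)
      then show ?thesis by (rule tendsto_eventually)
    qed (simp add: f_def)
    have lim: "(\<lambda>k. \<integral>x. f k x \<partial>P) \<longlonglongrightarrow> measure P C"
      if P: "finite_measure P" "sets P = sets borel" for P
    proof -
      interpret finite_measure P by fact
      note P(2)[measurable_cong]
      have "(\<lambda>k. \<integral>x. f k x \<partial>P) \<longlonglongrightarrow> (\<integral>x. indicator C x \<partial>P)"
      proof (rule integral_dominated_convergence[where w = "\<lambda>_. 1"])
        show "(indicator C :: 'b \<Rightarrow> real) \<in> borel_measurable P" using \<open>closed C\<close> P(2)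
          by (intro borel_measurable_indicator) simp
        show "f k \<in> borel_measurable P" for k
          by (subst measurable_cong_sets[OF P(2) refl]) (rule borel_measurable_continuous_onI[OF f_cont])
      qed (use f_lim f_bound in auto)
      moreover have "space P = UNIV" using sets_eq_imp_space_eq[OF P(2)] by simp
      ultimately show ?thesis by simp
    qed
    have "bounded (range (f k))" for k using f_bound by (auto simp: bounded_iff)
    then have "(\<Sum>i\<in>I. \<integral>x. f k x \<partial>M i) = (\<integral>x. f k x \<partial>N)" for k
      using f_cont by (intro eq)
    moreover have "(\<lambda>k. \<Sum>i\<in>I. \<integral>x. f k x \<partial>M i) \<longlonglongrightarrow> (\<Sum>i\<in>I. measure (M i) C)"
      using M by (intro tendsto_sum lim)
    ultimately have "(\<lambda>k. \<integral>x. f k x \<partial>N) \<longlonglongrightarrow> (\<Sum>i\<in>I. measure (M i) C)"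
      by (simp only:)
    then show ?thesis
      using lim[OF N] by (rule LIMSEQ_unique)
  qed simp
  interpret N: finite_measure N by fact
  have emeasure_closed: "emeasure (sum_measure borel I M) C = emeasure N C" if "closed C" for C
  proof -
    have "emeasure (sum_measure borel I M) C = (\<Sum>i\<in>I. emeasure (M i) C)"
      using I M that by (intro emeasure_sum_measure) auto
    also have "\<dots> = (\<Sum>i\<in>I. ennreal (measure (M i) C))"
      using M(1) by (intro sum.cong refl finite_measure.emeasure_eq_measure)
    also have "\<dots> = emeasure N C"
      using closed[OF that] by (simp add: N.emeasure_eq_measure sum_ennreal)
    finally show ?thesis .
  qed
  show ?thesis
  proof (rule measure_eqI_generator_eq[where E = "Collect closed" and \<Omega> = UNIV and A = "\<lambda>_. UNIV"])
    have "sets (borel :: 'b measure) = sigma_sets UNIV (Collect closed)"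
      by (subst borel_eq_closed) (rule sets_measure_of, simp)
    then show "sets (sum_measure borel I M) = sigma_sets UNIV (Collect closed)"
      "sets N = sigma_sets UNIV (Collect closed)" using N by simp_all
    show "emeasure (sum_measure borel I M) UNIV \<noteq> \<infinity>"
      using emeasure_closed[of UNIV] N.emeasure_finite by simp
  qed (auto simp: Int_stable_def emeasure_closed)
qed

section \<open>Typical sequences\<close>

lemma space_seq_space [simp]: "space seq_space = UNIV"
  by (simp add: seq_space_def space_PiM)

lemma measurable_seq_nth [measurable]: "(\<lambda>x. x n) \<in> measurable seq_space (count_space UNIV)"
  unfolding seq_space_def by measurable

lemma measurable_lshift [measurable]: "lshift \<in> measurable seq_space seq_space"
  unfolding lshift_def seq_space_def by (rule measurable_PiM_single') auto

lemma measurable_funpow_lshift [measurable]: "(lshift ^^ n) \<in> measurable seq_space seq_space"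
proof (induction n)
  case (Suc n)
  show ?case
    unfolding funpow.simps by (rule measurable_comp[OF Suc measurable_lshift])
qed (simp only: funpow.simps id_def measurable_ident_sets)

lemma cylinder_eq: "cylinder u = {x. \<forall>k<length u. x k = u ! k}"
  unfolding cylinder_def seq_take_def list_eq_iff_nth_eq by simp

lemma cylinder_in_sets [measurable]: "cylinder u \<in> sets seq_space"
proof -
  have "{x \<in> space seq_space. \<forall>k<length u. x k = u ! k} \<in> sets seq_space" by measurable
  then show ?thesis by (simp add: cylinder_eq)
qed

lemma measurable_seq_take [measurable]:
  "seq_take m \<in> measurable seq_space (count_space (UNIV :: 'a::finite list set))"
proof -
  have "seq_take m -` {u} = (if length u = m then cylinder u else {})" for u :: "'a list"
    by (auto simp: cylinder_def)
  then show ?thesis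
    unfolding measurable_count_space_eq2_countable by auto
qed

lemma subshift_iff:
  "x \<in> subshift \<theta> \<longleftrightarrow>
     (\<forall>i m. \<exists>a k. \<exists>v\<in>set_pmf (subst_pow \<theta> k [a]). sublist (seq_take m ((lshift ^^ i) x)) v)"
proof -
  have "map x [i..<j] = seq_take (j - i) ((lshift ^^ i) x)" for i j
    by (auto simp: seq_take_def funpow_lshift list_eq_iff_nth_eq)
  moreover have "map x [i..<i + m] = seq_take m ((lshift ^^ i) x)" for i m
    by (auto simp: seq_take_def funpow_lshift list_eq_iff_nth_eq)
  ultimately show ?thesis unfolding subshift_def mem_Collect_eq by metis
qed

lemma subshift_in_sets [measurable]: "subshift \<theta> \<in> sets seq_space"
proof -
  let ?W = "{u. \<exists>a k. \<exists>v\<in>set_pmf (subst_pow \<theta> k [a]). sublist u v}"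
  have "{x \<in> space seq_space. \<forall>i m. seq_take m ((lshift ^^ i) x) \<in> ?W} \<in> sets seq_space"
    by measurable
  also have "{x \<in> space seq_space. \<forall>i m. seq_take m ((lshift ^^ i) x) \<in> ?W} = subshift \<theta>"
    by (auto simp: subshift_iff)
  finally show ?thesis .
qed

lemma subshift_dense_in_sets [measurable]: "subshift_dense \<theta> \<in> sets seq_space"
proof -
  let ?U = "{seq_take m y | m y. y \<in> subshift \<theta>}"
  have "{x \<in> space seq_space. x \<in> subshift \<theta> \<and>
      (\<forall>u. u \<in> ?U \<longrightarrow> (\<exists>n. seq_take (length u) ((lshift ^^ n) x) = u))} \<in> sets seq_space"
    by measurable
  also have "{x \<in> space seq_space. x \<in> subshift \<theta> \<and>
      (\<forall>u. u \<in> ?U \<longrightarrow> (\<exists>n. seq_take (length u) ((lshift ^^ n) x) = u))} = subshift_dense \<theta>"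
  proof (rule set_eqI)
    fix x
    have "(\<forall>u. u \<in> ?U \<longrightarrow> (\<exists>n. seq_take (length u) ((lshift ^^ n) x) = u)) \<longleftrightarrow>
        (\<forall>y\<in>subshift \<theta>. \<forall>m. \<exists>n. seq_take m ((lshift ^^ n) x) = seq_take m y)"
      by (simp only: mem_Collect_eq) (metis length_seq_take)
    then show "x \<in> {x \<in> space seq_space. x \<in> subshift \<theta> \<and>
        (\<forall>u. u \<in> ?U \<longrightarrow> (\<exists>n. seq_take (length u) ((lshift ^^ n) x) = u))} \<longleftrightarrow> x \<in> subshift_dense \<theta>"
      unfolding subshift_dense_iff by simp
  qed
  finally show ?thesis .
qed

text \<open>
  Genericity is only tested on the countably many cylinders, so that almost every point is typical
  as soon as the ergodic theorem holds for each single cylinder.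
\<close>

definition typical :: "(nat \<Rightarrow> 'a) measure \<Rightarrow> (nat \<Rightarrow> 'a) \<Rightarrow> bool" where
  "typical \<rho> x \<longleftrightarrow> (\<forall>u. (\<lambda>n. birkhoff_sum lshift (indicator (cylinder u)) n x / real n)
     \<longlonglongrightarrow> measure \<rho> (cylinder u))"

lemma generic_imp_typical:
  fixes \<rho> :: "(nat \<Rightarrow> 'a) measure"
  assumes gen: "generic_point \<rho> x" and sets: "sets \<rho> = sets seq_space"
  shows "typical \<rho> x"
  unfolding typical_def
proof
  fix u :: "'a list"
  let ?f = "indicator (cylinder u) :: _ \<Rightarrow> real"
  have "continuous_map seq_top euclideanreal ?f"
    unfolding continuous_map_def
  proof (intro conjI allI impI)
    fix U :: "real set"
    show "openin seq_top {x \<in> topspace seq_top. ?f x \<in> U}"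
      unfolding openin_seq_top
    proof (intro ballI exI allI impI)
      fix z y
      assume z: "z \<in> {x \<in> topspace seq_top. ?f x \<in> U}"
        and yz: "seq_take (length u) y = seq_take (length u) z"
      have "?f y = ?f z" using yz by (simp add: cylinder_def indicator_def)
      then show "y \<in> {x \<in> topspace seq_top. ?f x \<in> U}" using z by simp
    qed
  qed simp
  moreover have "bounded (?f ` topspace seq_top)"
    by (rule boundedI[of _ 1]) (auto simp: indicator_def)
  ultimately have "(\<lambda>n. \<integral>x. ?f x \<partial>scale_measure (ennreal (1 / real n))
      (sum_measure seq_space {..<n} (\<lambda>k. return seq_space ((lshift ^^ k) x)))) \<longlonglongrightarrow> (\<integral>x. ?f x \<partial>\<rho>)"
    using gen unfolding generic_point_def weak_limit_def by blast
  moreover have "(\<integral>x. ?f x \<partial>scale_measure (ennreal (1 / real n))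
      (sum_measure seq_space {..<n} (\<lambda>k. return seq_space ((lshift ^^ k) x)))) =
      birkhoff_sum lshift ?f n x / real n" for n
    by (subst integral_scaled_sum_of_points) (auto simp: birkhoff_sum_def)
  ultimately have "(\<lambda>n. birkhoff_sum lshift ?f n x / real n) \<longlonglongrightarrow> (\<integral>x. ?f x \<partial>\<rho>)"
    by (simp only:)
  then show "(\<lambda>n. birkhoff_sum lshift ?f n x / real n) \<longlonglongrightarrow> measure \<rho> (cylinder u)"
    using sets_eq_imp_space_eq[OF sets] by simp
qed

lemma typical_visits_infinitely_often:
  assumes "typical \<rho> x" "0 < measure \<rho> (cylinder u)"
  shows "\<exists>n\<ge>N. (lshift ^^ n) x \<in> cylinder u"
proof (rule ccontr)
  assume *: "\<not> ?thesis"
  have "birkhoff_sum lshift (indicator (cylinder u)) n x \<le> real N" for n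
  proof -
    have "birkhoff_sum lshift (indicator (cylinder u)) n x = (\<Sum>i\<in>{..<n} \<inter> {..<N}. indicator (cylinder u) ((lshift ^^ i) x))"
      unfolding birkhoff_sum_def using * by (intro sum.mono_neutral_right) (auto simp: not_le)
    also have "\<dots> \<le> (\<Sum>i\<in>{..<n} \<inter> {..<N}. 1)"
      by (intro sum_mono) (auto simp: indicator_def)
    also have "\<dots> \<le> real N"
      using card_mono[of "{..<N}" "{..<n} \<inter> {..<N}"] by simp
    finally show ?thesis .
  qed
  then have "birkhoff_sum lshift (indicator (cylinder u)) n x / real n \<le> real N / real n" for n
    by (simp add: divide_right_mono)
  moreover have "(\<lambda>n. real N / real n) \<longlonglongrightarrow> 0" by (rule lim_const_over_n)
  moreover have "(\<lambda>n. birkhoff_sum lshift (indicator (cylinder u)) n x / real n)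
      \<longlonglongrightarrow> measure \<rho> (cylinder u)"
    using assms(1) by (simp add: typical_def)
  ultimately have "measure \<rho> (cylinder u) \<le> 0"
    by (blast intro: LIMSEQ_le)
  with assms(2) show False by simp
qed

text \<open>
  A cylinder of positive measure is visited at arbitrarily late times, so by every shift of \<open>x\<close> too.
\<close>

lemma typical_orbit_dense:
  assumes pos: "\<And>y l b u. y \<in> set_pmf (subst_pow \<theta> l [b]) \<Longrightarrow> sublist u y \<Longrightarrow> u \<noteq> [] \<Longrightarrow>
      0 < measure \<rho> (cylinder u)"
    and x: "x \<in> subshift \<theta>" "typical \<rho> x"
  shows "(lshift ^^ i) x \<in> subshift_dense \<theta>"
  unfolding subshift_dense_iff
proof (intro conjI ballI allI)
  show "(lshift ^^ i) x \<in> subshift \<theta>"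
    using x(1) unfolding subshift_iff funpow_lshift_add by blast
  fix y m assume y: "y \<in> subshift \<theta>"
  show "\<exists>n. seq_take m ((lshift ^^ n) ((lshift ^^ i) x)) = seq_take m y"
  proof (cases "m = 0")
    case False
    obtain a k v where "v \<in> set_pmf (subst_pow \<theta> k [a])" "sublist (seq_take m ((lshift ^^ 0) y)) v"
      using y unfolding subshift_iff by blast
    moreover have "seq_take m y \<noteq> []" using False by (metis length_seq_take length_0_conv)
    ultimately have "0 < measure \<rho> (cylinder (seq_take m y))" by (intro pos) auto
    then obtain n where "i \<le> n" "(lshift ^^ n) x \<in> cylinder (seq_take m y)"
      using typical_visits_infinitely_often[OF x(2)] by blast
    then show ?thesis
      by (intro exI[of _ "n - i"]) (simp add: funpow_lshift_add mem_cylinder_seq_take)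
  qed (simp add: seq_take_def)
qed

lemma step_function_eq_sum:
  fixes G :: "'a::finite list \<Rightarrow> real"
  shows "G (seq_take m x) = (\<Sum>u | length u = m. G u * indicator (cylinder u) x)"
proof -
  have fin: "finite {u :: 'a list. length u = m}"
    using finite_lists_length_eq[of "UNIV :: 'a set" m] by simp
  have "(\<Sum>u | length u = m. G u * indicator (cylinder u) x) =
    (\<Sum>u | length u = m. if u = seq_take m x then G u else 0)"
    by (intro sum.cong) (auto simp: cylinder_def indicator_def)
  also have "\<dots> = G (seq_take m x)" using fin by (simp add: sum.delta)
  finally show ?thesis by simp
qed

lemma typical_step_function_average:
  fixes G :: "'a::finite list \<Rightarrow> real"
  assumes "typical \<rho> x" and "prob_space \<rho>" and sets: "sets \<rho> = sets seq_space"
  shows "(\<lambda>n. birkhoff_sum lshift (\<lambda>y. G (seq_take m y)) n x / real n) \<longlonglongrightarrow> (\<integral>y. G (seq_take m y) \<partial>\<rho>)"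
proof -
  interpret prob_space \<rho> by fact
  note sets[measurable_cong]
  have space: "space \<rho> = UNIV" using sets_eq_imp_space_eq[OF sets] by simp
  have int: "integrable \<rho> (\<lambda>y. G u * indicator (cylinder u) y)" for u
    by (intro integrable_mult_right integrable_real_indicator) (auto simp: emeasure_eq_measure)
  have "(\<integral>y. G (seq_take m y) \<partial>\<rho>) = (\<Sum>u | length u = m. G u * measure \<rho> (cylinder u))"
    unfolding step_function_eq_sum[of G] using int by (simp add: space)
  moreover have "birkhoff_sum lshift (\<lambda>y. G (seq_take m y)) n x / real n =
    (\<Sum>u | length u = m. G u * (birkhoff_sum lshift (indicator (cylinder u)) n x / real n))" for n
    unfolding step_function_eq_sum[of G] birkhoff_sum_def
    by (subst sum.swap) (simp only: sum_distrib_left sum_divide_distrib times_divide_eq_right)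
  moreover have "(\<lambda>n. \<Sum>u | length u = m. G u * (birkhoff_sum lshift (indicator (cylinder u)) n x / real n))
      \<longlonglongrightarrow> (\<Sum>u | length u = m. G u * measure \<rho> (cylinder u))"
    using assms(1) unfolding typical_def by (intro tendsto_sum tendsto_mult tendsto_const) blast
  ultimately show ?thesis by simp
qed

section \<open>Averages along typical orbits\<close>

lemma average_shift_index:
  fixes g :: "nat \<Rightarrow> real"
  assumes "(\<lambda>n. (\<Sum>i<n. g i) / real n) \<longlonglongrightarrow> l" and "bounded (range g)"
  shows "(\<lambda>n. (\<Sum>i = 1..n. g i) / real n) \<longlonglongrightarrow> l"
proof -
  obtain B where B: "\<And>i. \<bar>g i\<bar> \<le> B" using assms(2) by (auto simp: bounded_iff)
  have sum: "(\<Sum>i = 1..n. g i) = (\<Sum>i<n. g i) + (g n - g 0)" for n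
    by (induction n) auto
  have "(\<lambda>n. (g n - g 0) / real n) \<longlonglongrightarrow> 0"
  proof (rule Lim_null_comparison)
    show "eventually (\<lambda>n. norm ((g n - g 0) / real n) \<le> (B + B) / real n) sequentially"
    proof (rule always_eventually, rule allI)
      fix n
      have "\<bar>g n - g 0\<bar> \<le> B + B" using B[of n] B[of 0] by linarith
      then show "norm ((g n - g 0) / real n) \<le> (B + B) / real n"
        by (simp add: abs_divide divide_right_mono)
    qed
    show "(\<lambda>n. (B + B) / real n) \<longlonglongrightarrow> 0" by (rule lim_const_over_n)
  qed
  from tendsto_add[OF assms(1) this] show ?thesis
    by (simp only: sum add_divide_distrib add_0_right)
qed

locale rauzy_distribution = rauzy_reference +
  fixes \<rho> :: "(nat \<Rightarrow> 'a) measure"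
  assumes prob_space_\<rho>: "prob_space \<rho>" and sets_\<rho>: "sets \<rho> = sets seq_space"
    and AE_dense: "AE x in \<rho>. x \<in> subshift_dense \<theta>"
begin

sublocale prob_space \<rho> by (rule prob_space_\<rho>)

declare sets_\<rho> [measurable_cong]

lemma space_\<rho> [simp]: "space \<rho> = UNIV"
  using sets_eq_imp_space_eq[OF sets_\<rho>] by simp

abbreviation \<rho>' :: "(nat \<Rightarrow> 'a) measure" where
  "\<rho>' \<equiv> restrict_space \<rho> (subshift_dense \<theta>)"

lemma dense_in_sets: "subshift_dense \<theta> \<in> sets \<rho>"
  by (simp add: sets_\<rho>)

lemma space_restricted: "space \<rho>' = subshift_dense \<theta>"
  by (simp add: space_restrict_space)

lemma prob_space_restricted: "prob_space \<rho>'"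
proof (rule prob_space_restrict_space)
  show "subshift_dense \<theta> \<in> sets \<rho>" by (rule dense_in_sets)
  show "emeasure \<rho> (subshift_dense \<theta>) = 1"
    using AE_dense dense_in_sets by (simp add: emeasure_eq_measure prob_eq_1)
qed

lemma measurable_restricted: "g \<in> measurable seq_space N \<Longrightarrow> g \<in> measurable \<rho>' N"
  by (rule measurable_restrict_space1) simp

lemma integral_restricted:
  fixes g :: "(nat \<Rightarrow> 'a) \<Rightarrow> real"
  assumes "g \<in> borel_measurable \<rho>"
  shows "(\<integral>x. g x \<partial>\<rho>') = (\<integral>x. g x \<partial>\<rho>)"
proof -
  have "(\<integral>x. g x \<partial>\<rho>') = (\<integral>x. indicator (subshift_dense \<theta>) x *\<^sub>R g x \<partial>\<rho>)"
    using dense_in_sets by (intro integral_restrict_space) simp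
  also have "\<dots> = (\<integral>x. g x \<partial>\<rho>)"
    using assms AE_dense dense_in_sets by (intro integral_cong_AE) auto
  finally show ?thesis .
qed

text \<open>
  The map \<open>\<phi>\<close> is the limit of the functions that send \<open>x\<close> to the point of the first shift of \<open>w\<close>
  agreeing with \<open>x\<close> in \<open>m\<close> letters; each of them depends on finitely many letters of \<open>x\<close>.
\<close>

lemma measurable_rauzy_shift: "\<phi> \<in> borel_measurable \<rho>'"
proof -
  define G where "G u = seq_point L R w (LEAST n. seq_take (length u) ((lshift ^^ n) w) = u)" for u
  show ?thesis
  proof (rule borel_measurable_LIMSEQ_metric[of "\<lambda>m x. G (seq_take m x)"])
    show "(\<lambda>x. G (seq_take m x)) \<in> borel_measurable \<rho>'" for m
      by (intro measurable_restricted measurable_compose[OF measurable_seq_take]) simp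
    fix x assume "x \<in> space \<rho>'"
    then have x: "x \<in> subshift_dense \<theta>" by (simp add: space_restricted)
    show "(\<lambda>m. G (seq_take m x)) \<longlonglongrightarrow> \<phi> x"
    proof (rule metric_LIMSEQ_I)
      fix e :: real assume "0 < e"
      then obtain m0 where m0: "\<And>n. seq_take m0 ((lshift ^^ n) w) = seq_take m0 x \<Longrightarrow>
          dist (seq_point L R w n) (\<phi> x) < e"
        using seq_point_close_to_rauzy_shift[OF x] by blast
      have "dist (G (seq_take m x)) (\<phi> x) < e" if "m0 \<le> m" for m
      proof -
        let ?P = "\<lambda>n. seq_take m ((lshift ^^ n) w) = seq_take m x"
        have "?P (LEAST n. ?P n)" using w_approximates[OF x] by (rule LeastI_ex)
        then have "dist (seq_point L R w (LEAST n. ?P n)) (\<phi> x) < e"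
          using that by (intro m0) (rule seq_take_mono)
        then show ?thesis by (simp add: G_def)
      qed
      then show "\<exists>m0. \<forall>m\<ge>m0. dist (G (seq_take m x)) (\<phi> x) < e" by blast
    qed
  qed
qed

text \<open>
  The function \<open>f \<circ> \<phi>\<close> is bounded above by the step functions that take on each cylinder its supremum
  over the points with dense orbit. Their averages along a typical orbit converge to their
  integrals, and these tend to the integral of \<open>f \<circ> \<phi>\<close>, because \<open>\<phi>\<close> is continuous on the set of
  points with dense orbit.
\<close>

lemma average_eventually_less:
  fixes f :: "real ^ 'a \<Rightarrow> real"
  assumes f: "continuous_on UNIV f" and B: "\<And>y. \<bar>f y\<bar> \<le> B"
    and x: "typical \<rho> x" "\<And>i. (lshift ^^ i) x \<in> subshift_dense \<theta>"
    and c: "(\<integral>y. f (\<phi> y) \<partial>\<rho>') < c"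
  shows "eventually (\<lambda>n. birkhoff_sum lshift (\<lambda>y. f (\<phi> y)) n x / real n < c) sequentially"
proof -
  interpret restricted: prob_space \<rho>' by (rule prob_space_restricted)
  define G where "G u = (SUP z\<in>{z \<in> subshift_dense \<theta>. seq_take (length u) z = u}. f (\<phi> z))" for u
  have bdd: "bdd_above ((\<lambda>z. f (\<phi> z)) ` A)" for A
    using B by (intro bdd_aboveI[of _ B]) (auto simp: abs_le_iff)
  have G_ge: "f (\<phi> y) \<le> G (seq_take m y)" if "y \<in> subshift_dense \<theta>" for m y
    unfolding G_def using that by (intro cSUP_upper bdd) auto
  have G_le: "G (seq_take m y) \<le> K"
    if "y \<in> subshift_dense \<theta>" "\<And>z. z \<in> subshift_dense \<theta> \<Longrightarrow> seq_take m z = seq_take m y \<Longrightarrow> f (\<phi> z) \<le> K"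
    for m y K
    unfolding G_def using that by (intro cSUP_least) auto
  have lim: "(\<lambda>m. \<integral>y. G (seq_take m y) \<partial>\<rho>') \<longlonglongrightarrow> (\<integral>y. f (\<phi> y) \<partial>\<rho>')"
  proof (rule integral_dominated_convergence[where w = "\<lambda>_. B"])
    show "(\<lambda>y. f (\<phi> y)) \<in> borel_measurable \<rho>'"
      using f by (intro measurable_compose[OF measurable_rauzy_shift] borel_measurable_continuous_onI)
    show "(\<lambda>y. G (seq_take m y)) \<in> borel_measurable \<rho>'" for m
      by (intro measurable_restricted measurable_compose[OF measurable_seq_take]) simp
    show "AE y in \<rho>'. norm (G (seq_take m y)) \<le> B" for m
    proof (rule AE_I2)
      fix y assume "y \<in> space \<rho>'"
      then have y: "y \<in> subshift_dense \<theta>" by (simp add: space_restricted)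
      have "G (seq_take m y) \<le> B" using B by (intro G_le[OF y]) (simp add: abs_le_iff)
      moreover have "- B \<le> G (seq_take m y)"
        using G_ge[OF y, of m] B[of "\<phi> y"] by linarith
      ultimately show "norm (G (seq_take m y)) \<le> B" by simp
    qed
    show "AE y in \<rho>'. (\<lambda>m. G (seq_take m y)) \<longlonglongrightarrow> f (\<phi> y)"
    proof (rule AE_I2, rule metric_LIMSEQ_I)
      fix y and e :: real assume "y \<in> space \<rho>'" and e: "0 < e"
      then have y: "y \<in> subshift_dense \<theta>" by (simp add: space_restricted)
      obtain d where d: "0 < d" "\<And>z. dist z (\<phi> y) < d \<Longrightarrow> dist (f z) (f (\<phi> y)) < e / 2"
        using f e unfolding continuous_on_iff by (metis UNIV_I half_gt_zero)
      obtain m0 where m0: "\<And>z. z \<in> subshift_dense \<theta> \<Longrightarrow> seq_take m0 z = seq_take m0 y \<Longrightarrow>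
          dist (\<phi> z) (\<phi> y) < d"
        using rauzy_shift_continuous[OF y d(1)] by blast
      have "dist (G (seq_take m y)) (f (\<phi> y)) < e" if m: "m0 \<le> m" for m
      proof -
        have "G (seq_take m y) \<le> f (\<phi> y) + e / 2"
        proof (rule G_le[OF y])
          fix z assume "z \<in> subshift_dense \<theta>" "seq_take m z = seq_take m y"
          then have "dist (f (\<phi> z)) (f (\<phi> y)) < e / 2"
            using m by (intro d(2) m0) (auto intro: seq_take_mono)
          then show "f (\<phi> z) \<le> f (\<phi> y) + e / 2" unfolding dist_real_def by linarith
        qed
        then show ?thesis using G_ge[OF y, of m] e unfolding dist_real_def by linarith
      qed
      then show "\<exists>m0. \<forall>m\<ge>m0. dist (G (seq_take m y)) (f (\<phi> y)) < e" by blast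
    qed
  qed auto
  obtain m where "(\<integral>y. G (seq_take m y) \<partial>\<rho>') < c"
    using order_tendstoD(2)[OF lim c] by (auto simp: eventually_sequentially)
  moreover have "(\<integral>y. G (seq_take m y) \<partial>\<rho>') = (\<integral>y. G (seq_take m y) \<partial>\<rho>)"
    by (intro integral_restricted, subst measurable_cong_sets[OF sets_\<rho> refl])
       (rule measurable_compose[OF measurable_seq_take], simp)
  ultimately have "eventually (\<lambda>n. birkhoff_sum lshift (\<lambda>y. G (seq_take m y)) n x / real n < c) sequentially"
    using typical_step_function_average[OF x(1) prob_space_\<rho> sets_\<rho>, of G m]
    by (intro order_tendstoD(2)) auto
  then show ?thesis
  proof eventually_elim
    case (elim n)
    have "birkhoff_sum lshift (\<lambda>y. f (\<phi> y)) n x \<le> birkhoff_sum lshift (\<lambda>y. G (seq_take m y)) n x"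
      unfolding birkhoff_sum_def by (intro sum_mono G_ge x(2))
    then have "birkhoff_sum lshift (\<lambda>y. f (\<phi> y)) n x / real n \<le>
        birkhoff_sum lshift (\<lambda>y. G (seq_take m y)) n x / real n"
      by (simp add: divide_right_mono)
    with elim show ?case by linarith
  qed
qed

definition \<nu> :: "(real ^ 'a) measure" where
  "\<nu> = distr \<rho>' borel \<phi>"

lemma prob_space_\<nu>: "prob_space \<nu>" and sets_\<nu> [simp, measurable_cong]: "sets \<nu> = sets borel"
  unfolding \<nu>_def
  by (auto intro!: prob_space.prob_space_distr[OF prob_space_restricted measurable_rauzy_shift])

lemma typical_average:
  fixes f :: "real ^ 'a \<Rightarrow> real"
  assumes f: "continuous_on UNIV f" "bounded (range f)"
    and x: "typical \<rho> x" "\<And>i. (lshift ^^ i) x \<in> subshift_dense \<theta>"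
  shows "(\<lambda>n. (\<Sum>i<n. f (\<phi> ((lshift ^^ i) x))) / real n) \<longlonglongrightarrow> (\<integral>y. f y \<partial>\<nu>)"
proof -
  obtain B where B: "\<And>y. \<bar>f y\<bar> \<le> B" using f(2) by (auto simp: bounded_iff)
  have int: "(\<integral>y. f y \<partial>\<nu>) = (\<integral>y. f (\<phi> y) \<partial>\<rho>')"
    unfolding \<nu>_def using f(1) by (intro integral_distr measurable_rauzy_shift borel_measurable_continuous_onI)
  have upper: "eventually (\<lambda>n. birkhoff_sum lshift (\<lambda>y. f (\<phi> y)) n x / real n < c) sequentially"
    if "(\<integral>y. f y \<partial>\<nu>) < c" for c
    using average_eventually_less[OF f(1) B x] that int by simp
  have lower: "eventually (\<lambda>n. c < birkhoff_sum lshift (\<lambda>y. f (\<phi> y)) n x / real n) sequentially"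
    if "c < (\<integral>y. f y \<partial>\<nu>)" for c
  proof -
    have "(\<integral>y. - f (\<phi> y) \<partial>\<rho>') < - c" using that int by simp
    then have "eventually (\<lambda>n. birkhoff_sum lshift (\<lambda>y. - f (\<phi> y)) n x / real n < - c) sequentially"
      using f(1) B by (intro average_eventually_less[where f = "\<lambda>y. - f y" and B = B, OF _ _ x]) (auto intro!: continuous_intros)
    then show ?thesis by (simp add: birkhoff_sum_def sum_negf)
  qed
  show ?thesis
    using upper lower by (intro order_tendstoI) (auto simp: birkhoff_sum_def)
qed

text \<open>The walk of \<open>x\<close> visits the points \<open>\<phi> (S\<^sup>i x) - \<phi> x\<close>.\<close>

lemma sequence_measure_typical:
  assumes x: "typical \<rho> x" "\<And>i. (lshift ^^ i) x \<in> subshift_dense \<theta>"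
  shows "sequence_measure L R x (distr \<nu> borel (\<lambda>y. y - \<phi> x))"
proof -
  let ?N = "distr \<nu> borel (\<lambda>y. y - \<phi> x)"
  interpret \<nu>: prob_space \<nu> by (rule prob_space_\<nu>)
  have "(\<lambda>n. \<integral>y. f y \<partial>scale_measure (ennreal (1 / real n))
      (sum_measure borel {1..n} (\<lambda>i. return borel (rauzy_point L R (seq_take i x))))) \<longlonglongrightarrow> (\<integral>y. f y \<partial>?N)"
    if f: "continuous_on UNIV f" "bounded (range f)" for f :: "real ^ 'a \<Rightarrow> real"
  proof -
    have meas: "f \<in> borel_measurable borel" using f(1) by (rule borel_measurable_continuous_onI)
    define g where "g y = f (y - \<phi> x)" for y
    have "continuous_on UNIV g"
      unfolding g_def by (intro continuous_on_compose2[OF f(1)] continuous_intros) auto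
    moreover have "bounded (range g)"
      using f(2) by (rule bounded_subset) (auto simp: g_def)
    ultimately have "(\<lambda>n. (\<Sum>i<n. g (\<phi> ((lshift ^^ i) x))) / real n) \<longlonglongrightarrow> (\<integral>y. g y \<partial>\<nu>)"
      by (rule typical_average[OF _ _ x])
    moreover have "g (\<phi> ((lshift ^^ i) x)) = f (seq_point L R x i)" for i
      using rauzy_shift_funpow[OF x(2), of i] by (simp add: g_def)
    ultimately have "(\<lambda>n. (\<Sum>i<n. f (seq_point L R x i)) / real n) \<longlonglongrightarrow> (\<integral>y. g y \<partial>\<nu>)"
      by simp
    moreover have "bounded (range (\<lambda>i. f (seq_point L R x i)))"
      using f(2) by (rule bounded_subset) auto
    ultimately have "(\<lambda>n. (\<Sum>i = 1..n. f (seq_point L R x i)) / real n) \<longlonglongrightarrow> (\<integral>y. g y \<partial>\<nu>)"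
      by (rule average_shift_index)
    moreover have "(\<integral>y. g y \<partial>\<nu>) = (\<integral>y. f y \<partial>?N)"
      unfolding g_def using meas by (intro integral_distr[symmetric]) auto
    moreover have "(\<integral>y. f y \<partial>scale_measure (ennreal (1 / real n))
      (sum_measure borel {1..n} (\<lambda>i. return borel (rauzy_point L R (seq_take i x))))) =
      (\<Sum>i = 1..n. f (seq_point L R x i)) / real n" for n
      using meas by (subst integral_scaled_sum_of_points) (auto simp: seq_point_def)
    ultimately show ?thesis by simp
  qed
  moreover have "finite_measure ?N"
    by (intro prob_space.finite_measure \<nu>.prob_space_distr) auto
  ultimately show ?thesis
    by (simp add: sequence_measure_def weak_limit_def)
qed

lemma distr_translate_back: "distr (distr \<nu> borel (\<lambda>y. y - v)) borel (\<lambda>y. y + v) = \<nu>"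
proof -
  have "distr (distr \<nu> borel (\<lambda>y. y - v)) borel (\<lambda>y. y + v) = distr \<nu> borel (\<lambda>y. y)"
    by (subst distr_distr) (auto simp: o_def)
  also have "\<dots> = \<nu>" by (rule distr_id2) simp
  finally show ?thesis .
qed

text \<open>
  Summing \<open>(1/n) \<mu>\<^sub>a(w\<^sub>1 \<dots> w\<^sub>n)\<close> over the letters \<open>a\<close> gives the empirical measure of the whole walk of
  \<open>w\<close>, which visits the points \<open>\<phi> (S\<^sup>i w)\<close> because \<open>\<phi> w = 0\<close>.
\<close>

lemma sum_rauzy_measures_eq:
  assumes w: "typical \<rho> w" "\<And>i. (lshift ^^ i) w \<in> subshift_dense \<theta>"
    and lim: "\<And>a. weak_limit euclidean
      (\<lambda>n. scale_measure (ennreal (1 / real n)) (word_measure L R a (seq_take n w))) (N a)"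
  shows "sum_measure borel UNIV N = \<nu>"
proof (rule sum_measure_eqI_continuous)
  show "finite_measure (N a)" "sets (N a) = sets borel" for a
    using lim[of a] by (auto simp: weak_limit_def word_measure_def)
  show "finite_measure \<nu>" by (rule prob_space.finite_measure[OF prob_space_\<nu>])
  fix f :: "real ^ 'a \<Rightarrow> real"
  assume f: "continuous_on UNIV f" "bounded (range f)"
  have meas: "f \<in> borel_measurable borel" using f(1) by (rule borel_measurable_continuous_onI)
  have word: "(\<integral>y. f y \<partial>scale_measure (ennreal (1 / real n)) (word_measure L R a (seq_take n w))) =
    (\<Sum>m<n. if w m = a then f (seq_point L R w m) else 0) / real n" for a n
  proof -
    have "(\<integral>y. f y \<partial>scale_measure (ennreal (1 / real n)) (word_measure L R a (seq_take n w))) =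
      (\<Sum>m | m < n \<and> seq_take n w ! m = a. f (rauzy_point L R (take m (seq_take n w)))) / real n"
      unfolding word_measure_def using meas by (subst integral_scaled_sum_of_points) auto
    also have "(\<Sum>m | m < n \<and> seq_take n w ! m = a. f (rauzy_point L R (take m (seq_take n w)))) =
      (\<Sum>m | m < n \<and> w m = a. f (seq_point L R w m))"
      by (intro sum.cong) (auto simp: seq_take_def seq_point_def take_map)
    also have "\<dots> = (\<Sum>m<n. if w m = a then f (seq_point L R w m) else 0)"
      by (simp add: sum.If_cases Int_def)
    finally show ?thesis .
  qed
  have "(\<lambda>n. \<Sum>a\<in>UNIV. (\<Sum>m<n. if w m = a then f (seq_point L R w m) else 0) / real n)
      \<longlonglongrightarrow> (\<Sum>a\<in>UNIV. \<integral>y. f y \<partial>N a)"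
  proof (rule tendsto_sum)
    fix a
    show "(\<lambda>n. (\<Sum>m<n. if w m = a then f (seq_point L R w m) else 0) / real n) \<longlonglongrightarrow> (\<integral>y. f y \<partial>N a)"
    proof -
      have "continuous_map euclidean euclideanreal f" "bounded (f ` topspace euclidean)"
        using f by simp_all
      then show ?thesis
        using lim[of a] unfolding weak_limit_def word[symmetric] by blast
    qed
  qed
  moreover have "(\<Sum>a\<in>UNIV. (\<Sum>m<n. if w m = a then f (seq_point L R w m) else 0) / real n) =
    (\<Sum>m<n. f (\<phi> ((lshift ^^ m) w))) / real n" for n
  proof -
    have "(\<Sum>a\<in>UNIV. (\<Sum>m<n. if w m = a then f (seq_point L R w m) else 0)) =
      (\<Sum>m<n. f (seq_point L R w m))"
      by (subst sum.swap) simp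
    moreover have "\<phi> ((lshift ^^ m) w) = seq_point L R w m" for m
      using rauzy_shift_funpow[OF w(2), of m] by (simp add: rauzy_shift_reference)
    ultimately show ?thesis by (simp flip: sum_divide_distrib)
  qed
  ultimately show "(\<Sum>a\<in>UNIV. \<integral>y. f y \<partial>N a) = (\<integral>y. f y \<partial>\<nu>)"
    using typical_average[OF f w] LIMSEQ_unique by fastforce
qed simp_all

end

section \<open>The distribution of the translation vector\<close>

theorem corollary5p16:
  fixes \<theta> :: "'a::finite \<Rightarrow> 'a list pmf"
    and L R :: "real ^ 'a"
    and \<mu>a :: "'a \<Rightarrow> (real ^ 'a) measure"
    and \<rho> :: "(nat \<Rightarrow> 'a) measure"
    and w :: "nat \<Rightarrow> 'a"
  defines "\<phi> \<equiv> rauzy_shift L R w"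
    and "\<mu> \<equiv> sum_measure borel UNIV \<mu>a"
  assumes "random_substitution \<theta>"
    and "compatible \<theta>"
    and "irreducible_pisot \<theta>"
    and "pf_eigenvectors (subst_matrix \<theta>) L R"
    and "\<And>a. rauzy_measure \<theta> L R a (\<mu>a a)"
    and "frequency_measure \<theta> \<rho>"
    and "w \<in> subshift_inf \<theta> \<inter> subshift_dense \<theta>"
    and "generic_point \<rho> w"
    and "\<And>a. weak_limit euclidean
               (\<lambda>n. scale_measure (ennreal (1 / real n)) (word_measure L R a (seq_take n w))) (\<mu>a a)"
  shows "\<mu> = distr (restrict_space \<rho> (subshift_dense \<theta>)) borel \<phi> \<and>
         (AE x in \<rho>. x \<in> subshift_dense \<theta> \<and>
            (\<exists>N. sequence_measure L R x N \<and> distr N borel (\<lambda>y. y + \<phi> x) = \<mu>))"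
proof -
  have \<rho>: "prob_space \<rho>" "sets \<rho> = sets seq_space" "AE x in \<rho>. x \<in> subshift \<theta>"
    "distr \<rho> seq_space lshift = \<rho>"
    "\<And>A. A \<in> sets \<rho> \<Longrightarrow> lshift -` A = A \<Longrightarrow> measure \<rho> A = 0 \<or> measure \<rho> A = 1"
    using assms(8) unfolding frequency_measure_def by blast+
  have space: "space \<rho> = UNIV" using sets_eq_imp_space_eq[OF \<rho>(2)] by simp
  interpret ergodic_system \<rho> lshift
  proof (intro ergodic_system.intro ergodic_system_axioms.intro)
    show "lshift \<in> measurable \<rho> \<rho>"
      using measurable_lshift by (simp add: measurable_cong_sets[OF \<rho>(2) \<rho>(2)])
    show "distr \<rho> \<rho> lshift = \<rho>"
      using \<rho>(4) distr_cong[OF refl \<rho>(2), where f = lshift and g = lshift] by simp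
    show "measure \<rho> A = 0 \<or> measure \<rho> A = 1" if "A \<in> sets \<rho>" "lshift -` A \<inter> space \<rho> = A" for A
      using \<rho>(5) that by (simp add: space)
  qed (rule \<rho>(1))
  have pos: "0 < measure \<rho> (cylinder u)"
    if "y \<in> set_pmf (subst_pow \<theta> l [b])" "sublist u y" "u \<noteq> []" for y l b u
    using frequency_pos[OF assms(3,4) _ assms(8) that] assms(5) by (simp add: irreducible_pisot_def)
  have dense: "(lshift ^^ i) x \<in> subshift_dense \<theta>" if "x \<in> subshift \<theta>" "typical \<rho> x" for x i
  proof (rule typical_orbit_dense)
    show "0 < measure \<rho> (cylinder u)"
      if "y \<in> set_pmf (subst_pow \<theta> l [b])" "sublist u y" "u \<noteq> []" for y l b u
      using that by (rule pos)
  qed (use that in auto)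
  have "AE x in \<rho>. (\<lambda>n. birkhoff_sum lshift (indicator (cylinder u)) n x / real n)
      \<longlonglongrightarrow> measure \<rho> (cylinder u)" for u
  proof -
    have "(indicator (cylinder u) :: _ \<Rightarrow> real) \<in> borel_measurable \<rho>"
      using \<rho>(2) by (intro borel_measurable_indicator) simp
    then have "AE x in \<rho>. (\<lambda>n. birkhoff_sum lshift (indicator (cylinder u)) n x / real n)
      \<longlonglongrightarrow> (\<integral>x. indicator (cylinder u) x \<partial>\<rho>)"
      by (rule birkhoff_ergodic_theorem[where B = 1]) (simp add: indicator_def)
    then show ?thesis by (simp add: space)
  qed
  then have "AE x in \<rho>. typical \<rho> x"
    unfolding typical_def by (subst AE_all_countable) blast
  with \<rho>(3) have AE: "AE x in \<rho>. typical \<rho> x \<and> (\<forall>i. (lshift ^^ i) x \<in> subshift_dense \<theta>)"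
  proof eventually_elim
    case (elim x)
    then show ?case using dense by blast
  qed
  interpret rauzy_distribution \<theta> L R w \<rho>
  proof
    show "w \<in> subshift_dense \<theta>" using assms(9) by simp
    then have "w \<in> subshift \<theta>" by (simp add: subshift_dense_def)
    then show "bounded (range (seq_point L R w))"
      using rauzy_points_of_subshift_bounded[OF assms(3-6)] by (simp add: seq_point_def[abs_def])
    show "AE x in \<rho>. x \<in> subshift_dense \<theta>"
      using AE by eventually_elim (metis funpow_0)
  qed (use \<rho> in simp_all)
  have w: "typical \<rho> w" by (rule generic_imp_typical[OF assms(10) \<rho>(2)])
  moreover have "w \<in> subshift \<theta>" using assms(9) by (simp add: subshift_dense_def)
  ultimately have "(lshift ^^ i) w \<in> subshift_dense \<theta>" for i
    by (intro dense)
  then have \<mu>: "\<mu> = \<nu>"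
    unfolding \<mu>_def using w assms(11) by (intro sum_rauzy_measures_eq)
  have "AE x in \<rho>. x \<in> subshift_dense \<theta> \<and>
      (\<exists>N. sequence_measure L R x N \<and> distr N borel (\<lambda>y. y + \<phi> x) = \<mu>)"
    using AE
  proof eventually_elim
    case (elim x)
    have "x \<in> subshift_dense \<theta>" using elim by (metis funpow_0)
    moreover have "sequence_measure L R x (distr \<nu> borel (\<lambda>y. y - \<phi> x))"
      unfolding \<phi>_def using elim by (intro sequence_measure_typical) auto
    ultimately show ?case using distr_translate_back \<mu> by blast
  qed
  with \<mu> show ?thesis by (simp add: \<nu>_def \<phi>_def)
qed

end
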